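(* Let $n\ge1$ be an integer, $0<s<1$ and $0<\alpha\le 1$. Let $f:\mathbb R\to\mathbb R$ and $g:[0,+\infty)\to\mathbb R$ satisfy: (F1) $f$ is strictly increasing and $\limsup_{x_1\to-\infty} f(x_1)|x_1|^{2s}\le 0$; (F2) $g$ is locally Lipschitz and nondecreasing in $(0,+\infty)$; moreover $g'(u)$ is continuous near $u=0$, $g(0)=0$, $g'(0)=0$, and $g(u)>0$ for $u\in(0,+\infty)$. Let $u(x,t)\in (C^2(\mathbb R^n)\cap\tilde{\mathcal L}_{2s})\times(C^1(\mathbb R)\cap\mathcal L^-_\alpha(\mathbb R))$ be a positive bounded classical solution of $$\partial_t^\alpha u(x,t)+(-\Delta)^s u(x,t)-\Delta u(x,t)=f(x_1)\,g(u(x,t)),\qquad (x,t)\in\mathbb R^n\times\mathbb R,$$ and suppose that $u$ is uniformly continuous. Then for each $t\in\mathbb R$, $u(x,t)$ is strictly monotone increasing along the $x_1$ direction.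
   Context: Here $x=(x_1,\dots,x_n)$, and $\Delta$ and $(-\Delta)^s$ act in $x$ for fixed $t$, with $$(-\Delta)^s u(x,t)=C_{n,s}\lim_{\varepsilon\to0}\int_{\mathbb R^n\setminus B_\varepsilon(x)}\frac{u(x,t)-u(y,t)}{|x-y|^{n+2s}}\,dy,\qquad C_{n,s}=\frac{4^s s\,\Gamma(\frac{n+2s}{2})}{\pi^{n/2}\Gamma(1-s)}.$$ For $0<\alpha<1$, $\partial_t^\alpha$ is the Marchaud fractional derivative $$\partial_t^\alpha u(x,t)=C_\alpha\int_{-\infty}^t\frac{u(x,t)-u(x,\tau)}{(t-\tau)^{1+\alpha}}\,d\tau,\qquad C_\alpha=\frac{\alpha}{\Gamma(1-\alpha)},$$ and for $\alpha=1$ it is the classical derivative $\partial_t u$. The notation $u\in (C^2(\mathbb R^n)\cap\tilde{\mathcal L}_{2s})\times(C^1(\mathbb R)\cap\mathcal L^-_\alpha(\mathbb R))$ means that $u(\cdot,t)$ belongs to the first space for each $t$ and $u(x,\cdot)$ belongs to the second space for each $x$. Here $\tilde{\mathcal L}_{2s}$ is the set of $u(\cdot,t)\in L^1_{loc}(\mathbb R^n)$ with $\int_{\mathbb R^n}\frac{|u(x,t)|}{1+|x|^{n+2s}}dx<+\infty$, and $\mathcal L^-_\alpha(\mathbb R)$ is the set of $u\in L^1_{loc}(\mathbb R)$ with $\int_{-\infty}^t\frac{|u(\tau)|}{1+|\tau|^{1+\alpha}}d\tau<+\infty$ for each $t\in\mathbb R$. A classical solution is a function in this class satisfying the equation pointwise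 in $\mathbb R^n\times\mathbb R$. "Positive" means $u>0$ everywhere. *)

theory Defs
  imports "HOL-Analysis.Analysis"
begin

definition partial_deriv :: "'n::finite \<Rightarrow> (real ^ 'n \<Rightarrow> real) \<Rightarrow> real ^ 'n \<Rightarrow> real" where
  "partial_deriv i v x = deriv (\<lambda>h. v (x + h *\<^sub>R axis i 1)) 0"

definition C1_space :: "(real ^ 'n::finite \<Rightarrow> real) set" where
  "C1_space = {v. \<forall>i. (\<forall>x. (\<lambda>h::real. v (x + h *\<^sub>R axis i 1)) field_differentiable (at 0))
      \<and> continuous_on UNIV (partial_deriv i v)}"

definition C2_space :: "(real ^ 'n::finite \<Rightarrow> real) set" where
  "C2_space = {v. v \<in> C1_space \<and> (\<forall>i. partial_deriv i v \<in> C1_space)}"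

definition laplacian :: "(real ^ 'n::finite \<Rightarrow> real) \<Rightarrow> real ^ 'n \<Rightarrow> real" where
  "laplacian v x = (\<Sum>i\<in>UNIV. partial_deriv i (partial_deriv i v) x)"

definition L1_loc :: "('a::euclidean_space \<Rightarrow> real) set" where
  "L1_loc = {v. \<forall>K. compact K \<longrightarrow> set_integrable lebesgue K v}"

definition L_tilde :: "real \<Rightarrow> (real ^ 'n::finite \<Rightarrow> real) set" where
  "L_tilde s = {v \<in> L1_loc.
      integrable lebesgue (\<lambda>x. \<bar>v x\<bar> / (1 + norm x powr (real CARD('n) + 2 * s)))}"

definition L_minus :: "real \<Rightarrow> (real \<Rightarrow> real) set" where
  "L_minus \<alpha> = {v \<in> L1_loc.
      \<forall>t. set_integrable lebesgue {..t} (\<lambda>\<tau>. \<bar>v \<tau>\<bar> / (1 + \<bar>\<tau>\<bar> powr (1 + \<alpha>)))}"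

definition frac_laplacian_const :: "real \<Rightarrow> real \<Rightarrow> real" where
  "frac_laplacian_const n s =
     4 powr s * s * Gamma ((n + 2 * s) / 2) / (pi powr (n / 2) * Gamma (1 - s))"

text \<open>On the intersection of \<open>C2_space\<close> and \<open>L_tilde s\<close>, with \<open>0 < s < 1\<close>, the truncated
  integrals converge absolutely and the limit exists, so neither \<open>Lim\<close> nor the Bochner
  integral takes a default value there. The same applies to \<open>marchaud\<close> on \<open>C\<^sup>1\<close> functions
  in \<open>L_minus \<alpha>\<close>, with \<open>0 < \<alpha> < 1\<close>.\<close>

definition frac_laplacian :: "real \<Rightarrow> (real ^ 'n::finite \<Rightarrow> real) \<Rightarrow> real ^ 'n \<Rightarrow> real" where
  "frac_laplacian s v x = frac_laplacian_const (real CARD('n)) s *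
     Lim (at_right 0) (\<lambda>\<epsilon>. LINT y : - ball x \<epsilon> | lebesgue.
       (v x - v y) / norm (x - y) powr (real CARD('n) + 2 * s))"

definition marchaud :: "real \<Rightarrow> (real \<Rightarrow> real) \<Rightarrow> real \<Rightarrow> real" where
  "marchaud \<alpha> v t = \<alpha> / Gamma (1 - \<alpha>) *
     (LINT \<tau> : {..<t} | lebesgue. (v t - v \<tau>) / (t - \<tau>) powr (1 + \<alpha>))"

definition time_deriv :: "real \<Rightarrow> (real \<Rightarrow> real) \<Rightarrow> real \<Rightarrow> real" where
  "time_deriv \<alpha> v t = (if \<alpha> = 1 then deriv v t else marchaud \<alpha> v t)"

text \<open>The index \<open>k\<close> singles out the coordinate called \<open>x\<^sub>1\<close>, since a finite index type
  carries no distinguished first element.\<close>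

definition classical_solution ::
  "real \<Rightarrow> real \<Rightarrow> 'n::finite \<Rightarrow> (real \<Rightarrow> real) \<Rightarrow> (real \<Rightarrow> real) \<Rightarrow> (real ^ 'n \<Rightarrow> real \<Rightarrow> real) \<Rightarrow> bool"
where
  "classical_solution s \<alpha> k f g u \<longleftrightarrow>
     (\<forall>t. (\<lambda>x. u x t) \<in> C2_space \<inter> L_tilde s) \<and>
     (\<forall>x. u x C1_differentiable_on UNIV \<and> u x \<in> L_minus \<alpha>) \<and>
     (\<forall>x t. time_deriv \<alpha> (u x) t + frac_laplacian s (\<lambda>y. u y t) x - laplacian (\<lambda>y. u y t) x
            = f (x $ k) * g (u x t))"

end

theory Submission
  imports Defs
begin

text \<open>The proof moves the plane \<open>x $ k = \<mu>\<close> from the far left to the right and compares \<open>u\<close> with its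
reflection. Write \<open>w x t = u (reflect k \<mu> x) t - u x t\<close>; the claim follows once \<open>w\<close> is positive on
every half-space \<open>x $ k < \<mu>\<close>.

Suppose that \<open>w\<close> has infimum \<open>- m < 0\<close> on such a half-space. At a minimum the time derivative and
\<open>- laplacian\<close> of \<open>w\<close> are nonpositive, and since \<open>w\<close> is antisymmetric with respect to the plane, its
fractional Laplacian is at most \<open>- c * m\<close> times the distance to the plane to the power \<open>- 2 * s\<close>
(\<open>antisymmetric_minimum_integral_le\<close>). The infimum need not be attained, but a small perturbation that
is localised at the scale of the distance to the plane repairs this at the cost of half the constant
(\<open>evolution_op_at_near_minimum\<close>). On the other side of the equation, strict monotonicity of \<open>f\<close>
contributes the positive term \<open>(f (2 * \<mu> - x $ k) - f (x $ k)) * g\<close>, and the remaining part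
\<open>f (x $ k) * (g (u (reflect k \<mu> x) t) - g (u x t))\<close> can be negative only where \<open>f > 0\<close>, in which
case it is at least \<open>- f (x $ k) * L * m\<close> for a Lipschitz constant \<open>L\<close> of \<open>g\<close>
(\<open>moving_plane_failure_point\<close>).

Three consequences follow. Since \<open>f r * \<bar>r\<bar> powr (2 * s)\<close> has limsup at most \<open>0\<close>, the point cannot lie
far to the left; in particular planes far to the left admit no violation. Since \<open>f\<close> is bounded above on
half-lines to the left, the point cannot lie close to the plane. Since \<open>g\<close> has slope \<open>0\<close> at \<open>0\<close>,
\<open>u\<close> cannot be small at the point. If the plane got stuck at some position, violations \<open>m\<close> for planes
slightly beyond it would tend to \<open>0\<close> by uniform continuity, whereas the jump of \<open>f\<close> and the value of \<open>g\<close>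
stay bounded below at the corresponding points: a contradiction, reached without passing to a limit of
translated solutions. So \<open>w\<close> is nonnegative for all planes. A zero of \<open>w\<close> in a half-space would be an attained
minimum, where the left-hand side is nonpositive but the jump of \<open>f\<close> makes the right-hand side
positive (\<open>evolution_op_at_zero_minimum\<close>).\<close>

section \<open>Second differences of twice differentiable functions\<close>

lemma C1_space_has_axis_derivative:
  assumes "v \<in> C1_space"
  shows "((\<lambda>h. v (y + h *\<^sub>R axis i 1)) has_real_derivative partial_deriv i v (y + t *\<^sub>R axis i 1)) (at t)"
proof -
  have "(\<lambda>h::real. v ((y + t *\<^sub>R axis i 1) + h *\<^sub>R axis i 1)) field_differentiable (at 0)"
    using assms by (auto simp: C1_space_def)
  then have "((\<lambda>h::real. v ((y + t *\<^sub>R axis i 1) + h *\<^sub>R axis i 1)) has_real_derivative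
      partial_deriv i v (y + t *\<^sub>R axis i 1)) (at 0)"
    unfolding partial_deriv_def by (simp add: field_differentiable_derivI)
  then have "((\<lambda>h::real. v (y + (t + h) *\<^sub>R axis i 1)) has_real_derivative
      partial_deriv i v (y + t *\<^sub>R axis i 1)) (at 0)"
    by (simp add: algebra_simps)
  then show ?thesis
    using DERIV_at_within_shift[of "\<lambda>h. v (y + h *\<^sub>R axis i 1)" _ t 0 UNIV] by simp
qed

text \<open>Changing one coordinate at a time reduces the increment \<open>v (x + z) - v x\<close> to one-dimensional mean
value theorems. Total differentiability of \<open>v\<close> is never formed: with \<open>a = 0\<close> this is a local
Lipschitz bound, and with \<open>a i = partial_deriv i v x\<close> it is a first-order Taylor estimate.\<close>

lemma C1_space_telescoping:
  fixes v :: "real ^ 'n::finite \<Rightarrow> real"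
  assumes v: "v \<in> C1_space"
    and B: "\<And>y i. norm (y - x) \<le> norm z \<Longrightarrow> \<bar>partial_deriv i v y - a i\<bar> \<le> B"
  shows "\<bar>v (x + z) - v x - (\<Sum>i\<in>UNIV. z $ i * a i)\<bar> \<le> B * (\<Sum>i\<in>UNIV. \<bar>z $ i\<bar>)"
proof -
  \<comment> \<open>the part of \<open>z\<close> carried by the coordinates in \<open>S\<close>\<close>
  define p where "p S = (\<chi> i. if i \<in> S then z $ i else 0)" for S
  note der = C1_space_has_axis_derivative[OF v]
  have "\<bar>v (x + p S) - v x - (\<Sum>i\<in>S. z $ i * a i)\<bar> \<le> B * (\<Sum>i\<in>S. \<bar>z $ i\<bar>)" for S
  proof (induction S rule: infinite_finite_induct)
    case (insert j S)
    have pj: "p (insert j S) = p S + (z $ j) *\<^sub>R axis j 1"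
      using insert by (auto simp: p_def vec_eq_iff axis_def)
    have "\<exists>\<theta>. 0 < \<theta> \<and> \<theta> < 1 \<and> v (x + p S + (1 * z $ j) *\<^sub>R axis j 1) - v (x + p S + (0 * z $ j) *\<^sub>R axis j 1)
        = (1 - 0) * (partial_deriv j v (x + p S + (\<theta> * z $ j) *\<^sub>R axis j 1) * z $ j)"
      by (rule MVT2[of 0 1 "\<lambda>\<theta>. v (x + p S + (\<theta> * z $ j) *\<^sub>R axis j 1)"])
         (auto intro!: DERIV_chain'[OF _ der] derivative_eq_intros)
    then obtain \<theta> where th: "0 < \<theta>" "\<theta> < 1" "v (x + p S + (z $ j) *\<^sub>R axis j 1) - v (x + p S)
        = partial_deriv j v (x + p S + (\<theta> * z $ j) *\<^sub>R axis j 1) * z $ j" by auto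
    have "norm ((x + p S + (\<theta> * z $ j) *\<^sub>R axis j 1) - x) \<le> norm z"
      using th(1,2) insert(2)
      by (intro norm_le_componentwise_cart) (auto simp: p_def axis_def abs_mult mult_left_le_one_le)
    then have "\<bar>partial_deriv j v (x + p S + (\<theta> * z $ j) *\<^sub>R axis j 1) - a j\<bar> \<le> B" by (rule B)
    then have "\<bar>z $ j\<bar> * \<bar>partial_deriv j v (x + p S + (\<theta> * z $ j) *\<^sub>R axis j 1) - a j\<bar> \<le> \<bar>z $ j\<bar> * B"
      by (intro mult_left_mono) auto
    then have "\<bar>v (x + p (insert j S)) - v (x + p S) - z $ j * a j\<bar> \<le> B * \<bar>z $ j\<bar>"
      using th(3) by (simp add: pj abs_mult[symmetric] algebra_simps)
    then show ?case using insert by (simp add: algebra_simps)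
  qed (auto simp: p_def zero_vec_def[symmetric])
  from this[of UNIV] show ?thesis by (simp add: p_def)
qed

lemma sum_abs_component_le: "(\<Sum>i\<in>UNIV. \<bar>(z::real^'n::finite) $ i\<bar>) \<le> real CARD('n) * norm z"
  using sum_bounded_above[of UNIV "\<lambda>i. \<bar>z $ i\<bar>" "norm z"] by (simp add: component_le_norm_cart)

lemma partial_deriv_bounded_cball:
  fixes v :: "real ^ 'n::finite \<Rightarrow> real"
  assumes "v \<in> C1_space"
  obtains B where "0 \<le> B" "\<And>y i. norm (y - x) \<le> 1 \<Longrightarrow> \<bar>partial_deriv i v y\<bar> \<le> B"
proof -
  have "\<exists>B. \<forall>y\<in>cball x 1. \<bar>partial_deriv i v y\<bar> \<le> B" for i
  proof -
    have "continuous_on (cball x 1) (partial_deriv i v)"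
      using assms by (auto simp: C1_space_def intro: continuous_on_subset[OF _ subset_UNIV])
    then have "bounded (partial_deriv i v ` cball x 1)"
      by (intro compact_imp_bounded compact_continuous_image) auto
    then show ?thesis by (auto simp: bounded_iff)
  qed
  then obtain B where B: "\<And>i y. y \<in> cball x 1 \<Longrightarrow> \<bar>partial_deriv i v y\<bar> \<le> B i" by metis
  have B0: "B i \<ge> 0" for i using B[of x i] by force
  show ?thesis
  proof
    show "0 \<le> (\<Sum>i\<in>UNIV. B i)" using B0 by (simp add: sum_nonneg)
    fix y i assume "norm (y - x) \<le> 1"
    then have "\<bar>partial_deriv i v y\<bar> \<le> B i" using B by (auto simp: dist_norm norm_minus_commute)
    also have "\<dots> \<le> (\<Sum>i\<in>UNIV. B i)" using B0 by (intro member_le_sum) auto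
    finally show "\<bar>partial_deriv i v y\<bar> \<le> (\<Sum>i\<in>UNIV. B i)" .
  qed
qed

text \<open>The telescoping estimate is used twice: first for the partial derivatives, which are therefore
locally Lipschitz, and then for \<open>v\<close> itself, whose linear Taylor term cancels in the symmetric
difference. The quadratic bound is what makes the singular integral of the fractional Laplacian
converge absolutely after symmetrisation.\<close>

lemma C2_space_second_difference_bound:
  fixes v :: "real ^ 'n::finite \<Rightarrow> real"
  assumes v: "v \<in> C2_space"
  obtains C where "0 \<le> C" "\<And>z. norm z \<le> 1 \<Longrightarrow> \<bar>2 * v x - v (x + z) - v (x - z)\<bar> \<le> C * (norm z)\<^sup>2"
proof -
  have v1: "v \<in> C1_space" and v2: "\<And>i. partial_deriv i v \<in> C1_space"
    using v by (auto simp: C2_space_def)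
  have "\<exists>B\<ge>0. \<forall>y j. norm (y - x) \<le> 1 \<longrightarrow> \<bar>partial_deriv j (partial_deriv i v) y\<bar> \<le> B" for i
    using partial_deriv_bounded_cball[OF v2[of i]] by metis
  then obtain B where B0: "\<And>i. 0 \<le> B i" and
    B: "\<And>i y j. norm (y - x) \<le> 1 \<Longrightarrow> \<bar>partial_deriv j (partial_deriv i v) y\<bar> \<le> B i" by metis
  define b where "b = (\<Sum>i\<in>UNIV. B i)"
  have b0: "0 \<le> b" and Bb: "B i \<le> b" for i
    using B0 by (auto simp: b_def intro: sum_nonneg member_le_sum)
  let ?N = "real CARD('n)"
  have lip: "\<bar>partial_deriv i v y - partial_deriv i v x\<bar> \<le> b * ?N * norm (y - x)" if "norm (y - x) \<le> 1" for i y
  proof -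
    have "\<bar>partial_deriv i v (x + (y - x)) - partial_deriv i v x - (\<Sum>j\<in>UNIV. (y - x) $ j * 0)\<bar>
        \<le> b * (\<Sum>j\<in>UNIV. \<bar>(y - x) $ j\<bar>)"
    proof (rule C1_space_telescoping[OF v2])
      fix y' j assume "norm (y' - x) \<le> norm (y - x)"
      then have "\<bar>partial_deriv j (partial_deriv i v) y'\<bar> \<le> B i" using B that by (meson order_trans)
      with Bb[of i] show "\<bar>partial_deriv j (partial_deriv i v) y' - 0\<bar> \<le> b" by simp
    qed
    also have "\<dots> \<le> b * (?N * norm (y - x))"
      by (intro mult_left_mono sum_abs_component_le b0)
    finally show ?thesis by (simp add: mult.assoc)
  qed
  have taylor: "\<bar>v (x + z) - v x - (\<Sum>i\<in>UNIV. z $ i * partial_deriv i v x)\<bar> \<le> b * ?N * ?N * (norm z)\<^sup>2"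
    if z: "norm z \<le> 1" for z
  proof -
    have "\<bar>v (x + z) - v x - (\<Sum>i\<in>UNIV. z $ i * partial_deriv i v x)\<bar>
        \<le> (b * ?N * norm z) * (\<Sum>i\<in>UNIV. \<bar>z $ i\<bar>)"
    proof (rule C1_space_telescoping[OF v1])
      fix y i assume y: "norm (y - x) \<le> norm z"
      have "b * ?N * norm (y - x) \<le> b * ?N * norm z" using y b0 by (intro mult_left_mono) auto
      with lip[of y i] y z show "\<bar>partial_deriv i v y - partial_deriv i v x\<bar> \<le> b * ?N * norm z" by simp
    qed
    also have "\<dots> \<le> (b * ?N * norm z) * (?N * norm z)"
      using b0 by (intro mult_left_mono sum_abs_component_le) auto
    finally show ?thesis by (simp add: power2_eq_square mult_ac)
  qed
  show ?thesis
  proof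
    show "0 \<le> 2 * (b * ?N * ?N)" using b0 by simp
    fix z :: "real^'n" assume z: "norm z \<le> 1"
    have "(\<Sum>i\<in>UNIV. (- z) $ i * partial_deriv i v x) = - (\<Sum>i\<in>UNIV. z $ i * partial_deriv i v x)"
      by (simp add: sum_negf)
    then show "\<bar>2 * v x - v (x + z) - v (x - z)\<bar> \<le> 2 * (b * ?N * ?N) * (norm z)\<^sup>2"
      using taylor[of z] taylor[of "-z"] z by (simp add: abs_le_iff)
  qed
qed

text \<open>The Laplacian is read off from second difference quotients. This form is invariant under a
reflection of the axis, and it can be compared with functions that are not differentiable.\<close>

lemma C2_space_axis_difference_quotient:
  fixes v :: "real ^ 'n::finite \<Rightarrow> real"
  assumes v: "v \<in> C2_space"
  shows "((\<lambda>h. (v (x + h *\<^sub>R axis i 1) + v (x - h *\<^sub>R axis i 1) - 2 * v x) / h\<^sup>2)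
      \<longlongrightarrow> partial_deriv i (partial_deriv i v) x) (at_right 0)"
proof -
  have v1: "v \<in> C1_space" and v2: "partial_deriv i v \<in> C1_space"
    using v by (auto simp: C2_space_def)
  define \<phi> where "\<phi> h = v (x + h *\<^sub>R axis i 1)" for h
  define \<psi> where "\<psi> h = partial_deriv i v (x + h *\<^sub>R axis i 1)" for h
  define l where "l = partial_deriv i (partial_deriv i v) x"
  have d1: "(\<phi> has_real_derivative \<psi> t) (at t)" for t
    unfolding \<phi>_def \<psi>_def by (rule C1_space_has_axis_derivative[OF v1])
  have d2: "(\<psi> has_real_derivative l) (at 0)"
    using C1_space_has_axis_derivative[OF v2, of x i 0] unfolding \<psi>_def l_def by simp
  have "((\<lambda>h. \<psi> (-h)) has_real_derivative - l) (at 0)"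
    using DERIV_mirror[of \<psi> l 0] d2 by simp
  then have "((\<lambda>h. \<psi> h - \<psi> (-h)) has_real_derivative 2 * l) (at 0)"
    using DERIV_diff[OF d2] by fastforce
  then have "((\<lambda>h. (\<psi> h - \<psi> (-h)) / h) \<longlongrightarrow> 2 * l) (at 0)"
    by (simp add: DERIV_def)
  then have "((\<lambda>h. (\<psi> h - \<psi> (-h)) / h / 2) \<longlongrightarrow> 2 * l / 2) (at_right 0)"
    by (intro tendsto_divide tendsto_const) (auto intro: filterlim_mono at_within_le_at)
  then have q: "((\<lambda>h. (\<psi> h - \<psi> (-h)) / (2 * h)) \<longlongrightarrow> l) (at_right 0)"
    by (simp add: mult.commute)
  have d3: "((\<lambda>h. \<phi> h + \<phi> (-h) - 2 * \<phi> 0) has_real_derivative \<psi> h - \<psi> (-h)) (at h)" for h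
    using DERIV_mirror[of \<phi> "\<psi> (-h)" h] d1[of "-h"] d1[of h]
    by (auto intro!: derivative_eq_intros)
  have "((\<lambda>h. (\<phi> h + \<phi> (-h) - 2 * \<phi> 0) / h\<^sup>2) \<longlongrightarrow> l) (at_right 0)"
  proof (rule lhopital_right_0[where f' = "\<lambda>h. \<psi> h - \<psi> (-h)" and g' = "\<lambda>h. 2 * h"])
    have "isCont (\<lambda>h. \<phi> h + \<phi> (-h) - 2 * \<phi> 0) 0" using d3 DERIV_isCont by blast
    then have "((\<lambda>h. \<phi> h + \<phi> (-h) - 2 * \<phi> 0) \<longlongrightarrow> 0) (at 0)" by (simp add: isCont_def)
    then show "((\<lambda>h. \<phi> h + \<phi> (-h) - 2 * \<phi> 0) \<longlongrightarrow> 0) (at_right 0)"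
      by (auto intro: filterlim_mono at_within_le_at)
    have "((\<lambda>h::real. h\<^sup>2) \<longlongrightarrow> 0\<^sup>2) (at_right 0)" by (intro tendsto_intros)
    then show "((\<lambda>h::real. h\<^sup>2) \<longlongrightarrow> 0) (at_right 0)" by simp
    show "\<forall>\<^sub>F h in at_right 0. h\<^sup>2 \<noteq> (0::real)" "\<forall>\<^sub>F h in at_right 0. 2 * h \<noteq> (0::real)"
      by (auto simp: eventually_at_filter)
    show "\<forall>\<^sub>F h in at_right 0. ((\<lambda>h. \<phi> h + \<phi> (-h) - 2 * \<phi> 0) has_real_derivative \<psi> h - \<psi> (-h)) (at h)"
      using d3 by simp
    show "\<forall>\<^sub>F h in at_right 0. ((\<lambda>h::real. h\<^sup>2) has_real_derivative 2 * h) (at h)"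
      by (intro always_eventually allI) (auto intro!: derivative_eq_intros)
  qed (rule q)
  then show ?thesis by (simp add: \<phi>_def l_def)
qed

section \<open>The truncated kernel of the fractional Laplacian\<close>

lemma ennreal_le_suminf: "f k \<le> (\<Sum>k. f k :: ennreal)"
  using sum_le_suminf[of f "{k}"] by simp

text \<open>The exponents \<open>2 - n - 2 s > - n\<close> at the origin and \<open>- n - 2 s < - n\<close> at infinity are both
integrable. On the dyadic shells outside and inside the unit ball, the kernel is bounded by the
constants \<open>a k\<close> and \<open>b k\<close>, and multiplied with the volume of the enclosing balls these give two
geometric series.\<close>

lemma integrable_fractional_kernel:
  fixes s :: real
  assumes s: "0 < s" "s < 1"
  shows "integrable lborel (\<lambda>z::'a::euclidean_space. min ((norm z)\<^sup>2) 1 / norm z powr (real DIM('a) + 2 * s))"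
proof -
  define n where "n = real DIM('a)"
  define p where "p = n + 2 * s"
  define F where "F z = min ((norm z)\<^sup>2) 1 / norm z powr p" for z :: 'a
  define a where "a k = 2 powr (- p * real k)" for k :: nat
  define b where "b k = 2 powr (p + (p - 2) * real k)" for k :: nat
  define A where "A k = cball (0::'a) (2 powr (real k + 1))" for k :: nat
  define B where "B k = cball (0::'a) (2 powr (- real k))" for k :: nat
  have p0: "0 < p" using s by (simp add: p_def n_def)
  have F0: "0 \<le> F z" for z by (simp add: F_def)
  have Fm[measurable]: "F \<in> borel_measurable borel" unfolding F_def by measurable
  have [measurable]: "A k \<in> sets borel" "B k \<in> sets borel" for k by (auto simp: A_def B_def)
  have emA: "emeasure lborel (A k) = ennreal (unit_ball_vol n * 2 powr (n * (real k + 1)))"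
    and emB: "emeasure lborel (B k) = ennreal (unit_ball_vol n * 2 powr (- n * real k))" for k
    by (auto simp: A_def B_def emeasure_cball n_def powr_powr mult.commute powr_realpow[symmetric])
  have le: "ennreal (F z) \<le> (\<Sum>k. ennreal (a k) * indicator (A k) z) + (\<Sum>k. ennreal (b k) * indicator (B k) z)" for z
  proof -
    consider "z = 0" | "1 \<le> norm z" | "0 < norm z" "norm z < 1" by force
    then show ?thesis
    proof cases
      case 1 then show ?thesis by (simp add: F_def)
    next
      case 2
      define k where "k = nat \<lfloor>log 2 (norm z)\<rfloor>"
      have n0: "0 < norm z" using 2 by linarith
      have "0 \<le> log 2 (norm z)" using 2 n0 by (simp add: zero_le_log_cancel_iff del: norm_ge_zero)
      then have k: "real k \<le> log 2 (norm z)" "log 2 (norm z) < real k + 1"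
        unfolding k_def by linarith+
      then have k1: "2 powr real k \<le> norm z" and k2: "norm z < 2 powr (real k + 1)"
        using k le_log_iff[of 2 "norm z" "real k"] log_less_iff[of 2 "norm z" "real k + 1"] n0 by simp_all
      have "F z \<le> 1 / norm z powr p" unfolding F_def by (intro divide_right_mono) auto
      also have "\<dots> \<le> 1 / (2 powr real k) powr p"
        using n0 k1 p0 by (intro divide_left_mono powr_mono2 mult_pos_pos) auto
      also have "\<dots> = a k" by (simp add: a_def powr_powr powr_minus_divide mult.commute)
      finally have "ennreal (F z) \<le> ennreal (a k) * indicator (A k) z"
        using k2 by (auto simp: A_def ennreal_leI)
      also have "\<dots> \<le> (\<Sum>k. ennreal (a k) * indicator (A k) z)"
        by (rule ennreal_le_suminf)
      finally show ?thesis by (simp add: add_increasing2)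
    next
      case 3
      define k where "k = nat \<lfloor>- log 2 (norm z)\<rfloor>"
      have n0: "0 < norm z" using 3 by linarith
      have "0 \<le> - log 2 (norm z)" using 3 n0 by (simp add: log_le_zero_cancel_iff)
      then have k: "- real k \<ge> log 2 (norm z)" "log 2 (norm z) > - (real k + 1)"
        unfolding k_def by linarith+
      then have k1: "2 powr (- (real k + 1)) \<le> norm z" and k2: "norm z \<le> 2 powr (- real k)"
        using k less_log_iff[of 2 "norm z" "- (real k + 1)"] log_le_iff[of 2 "norm z" "- real k"] n0
        by (auto simp: less_imp_le)
      have "F z \<le> (norm z)\<^sup>2 / norm z powr p" unfolding F_def by (intro divide_right_mono) auto
      also have "\<dots> \<le> (2 powr (- real k))\<^sup>2 / norm z powr p"
        using k2 by (intro divide_right_mono power_mono) auto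
      also have "\<dots> \<le> (2 powr (- real k))\<^sup>2 / (2 powr (- (real k + 1))) powr p"
        using n0 k1 p0 by (intro divide_left_mono powr_mono2 mult_pos_pos) auto
      also have "\<dots> = b k"
      proof -
        have "(2 powr (- real k))\<^sup>2 = 2 powr (- 2 * real k)" by (simp add: powr_power)
        moreover have "(2 powr (- (real k + 1))) powr p = 2 powr (- (real k + 1) * p)" by (simp only: powr_powr)
        moreover have "- 2 * real k - - (real k + 1) * p = p + (p - 2) * real k" by (simp add: algebra_simps)
        ultimately show ?thesis by (simp only: b_def powr_diff[symmetric])
      qed
      finally have "ennreal (F z) \<le> ennreal (b k) * indicator (B k) z"
        using k2 by (auto simp: B_def ennreal_leI)
      also have "\<dots> \<le> (\<Sum>k. ennreal (b k) * indicator (B k) z)"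
        by (rule ennreal_le_suminf)
      finally show ?thesis by (simp add: add_increasing)
    qed
  qed
  have "summable (\<lambda>k. (2 powr (- 2 * s)) ^ k)"
    using s by (intro summable_geometric) (simp add: powr_less_one)
  then have sa: "summable (\<lambda>k. (unit_ball_vol n * 2 powr n) * (2 powr (- 2 * s)) ^ k)"
    by (rule summable_mult)
  have "summable (\<lambda>k. (2 powr (2 * s - 2)) ^ k)"
    using s by (intro summable_geometric) (simp add: powr_less_one)
  then have sb: "summable (\<lambda>k. (unit_ball_vol n * 2 powr p) * (2 powr (2 * s - 2)) ^ k)"
    by (rule summable_mult)
  have eqA: "ennreal (a k) * emeasure lborel (A k)
      = ennreal ((unit_ball_vol n * 2 powr n) * (2 powr (- 2 * s)) ^ k)" for k
  proof -
    have g: "(2 powr (- 2 * s)) ^ k = 2 powr (- 2 * s * real k)" by (simp add: powr_power mult.commute)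
    have e: "- p * real k + n * (real k + 1) = n + - 2 * s * real k" by (simp add: p_def algebra_simps)
    have "a k * 2 powr (n * (real k + 1)) = 2 powr n * (2 powr (- 2 * s)) ^ k"
      unfolding a_def g powr_add[symmetric] e ..
    then have "a k * (unit_ball_vol n * 2 powr (n * (real k + 1))) = (unit_ball_vol n * 2 powr n) * (2 powr (- 2 * s)) ^ k"
      by (simp only: mult.left_commute mult.assoc)
    then show ?thesis unfolding emA by (simp add: ennreal_mult[symmetric] a_def n_def)
  qed
  have eqB: "ennreal (b k) * emeasure lborel (B k)
      = ennreal ((unit_ball_vol n * 2 powr p) * (2 powr (2 * s - 2)) ^ k)" for k
  proof -
    have g: "(2 powr (2 * s - 2)) ^ k = 2 powr ((2 * s - 2) * real k)" by (simp add: powr_power mult.commute)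
    have e: "p + (p - 2) * real k + - n * real k = p + (2 * s - 2) * real k" by (simp add: p_def algebra_simps)
    have "b k * 2 powr (- n * real k) = 2 powr p * (2 powr (2 * s - 2)) ^ k"
      unfolding b_def g powr_add[symmetric] e ..
    then have "b k * (unit_ball_vol n * 2 powr (- n * real k)) = (unit_ball_vol n * 2 powr p) * (2 powr (2 * s - 2)) ^ k"
      by (simp only: mult.left_commute mult.assoc)
    then show ?thesis unfolding emB by (simp add: ennreal_mult[symmetric] b_def n_def)
  qed
  have "(\<integral>\<^sup>+z. ennreal (F z) \<partial>lborel) \<le>
      (\<integral>\<^sup>+z. (\<Sum>k. ennreal (a k) * indicator (A k) z) + (\<Sum>k. ennreal (b k) * indicator (B k) z) \<partial>lborel)"
    by (intro nn_integral_mono le)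
  also have "\<dots> = (\<integral>\<^sup>+z. (\<Sum>k. ennreal (a k) * indicator (A k) z) \<partial>lborel)
      + (\<integral>\<^sup>+z. (\<Sum>k. ennreal (b k) * indicator (B k) z) \<partial>lborel)"
    by (rule nn_integral_add) measurable
  also have "(\<integral>\<^sup>+z. (\<Sum>k. ennreal (a k) * indicator (A k) z) \<partial>lborel)
      = (\<Sum>k. ennreal (a k) * emeasure lborel (A k))"
    by (subst nn_integral_suminf) (auto simp: nn_integral_cmult_indicator)
  also have "(\<integral>\<^sup>+z. (\<Sum>k. ennreal (b k) * indicator (B k) z) \<partial>lborel)
      = (\<Sum>k. ennreal (b k) * emeasure lborel (B k))"
    by (subst nn_integral_suminf) (auto simp: nn_integral_cmult_indicator)
  also have "(\<Sum>k. ennreal (a k) * emeasure lborel (A k)) + (\<Sum>k. ennreal (b k) * emeasure lborel (B k)) =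
    (\<Sum>k. ennreal ((unit_ball_vol n * 2 powr n) * (2 powr (- 2 * s)) ^ k)) +
      (\<Sum>k. ennreal ((unit_ball_vol n * 2 powr p) * (2 powr (2 * s - 2)) ^ k))"
    by (simp only: eqA eqB)
  also have "(\<Sum>k. ennreal ((unit_ball_vol n * 2 powr n) * (2 powr (- 2 * s)) ^ k)) +
      (\<Sum>k. ennreal ((unit_ball_vol n * 2 powr p) * (2 powr (2 * s - 2)) ^ k)) < \<infinity>"
  proof -
    have w: "0 \<le> unit_ball_vol n" by (simp add: n_def)
    have "(\<Sum>k. ennreal ((unit_ball_vol n * 2 powr n) * (2 powr (- 2 * s)) ^ k)) \<noteq> top"
      using w by (intro ennreal_suminf_neq_top[OF sa] mult_nonneg_nonneg zero_le_power) auto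
    moreover have "(\<Sum>k. ennreal ((unit_ball_vol n * 2 powr p) * (2 powr (2 * s - 2)) ^ k)) \<noteq> top"
      using w by (intro ennreal_suminf_neq_top[OF sb] mult_nonneg_nonneg zero_le_power) auto
    ultimately show ?thesis by (simp add: less_top[symmetric])
  qed
  finally have "(\<integral>\<^sup>+z. ennreal (F z) \<partial>lborel) < \<infinity>" .
  then have "integrable lborel F"
    using F0 by (intro integrableI_nonneg) auto
  then show ?thesis unfolding F_def p_def n_def .
qed

text \<open>The kernel is homogeneous, so truncating it at scale \<open>r\<close> costs exactly a factor \<open>r powr (- 2 * s)\<close>.
This is the same power of the distance to the plane as the gain in the maximum principle below,
which keeps all estimates uniform as that distance tends to infinity.\<close>

lemma integral_fractional_kernel_scaled:
  fixes s r :: real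
  assumes s: "0 < s" "s < 1" and r: "0 < r"
  defines "\<Phi> \<equiv> \<lambda>r (z::'a::euclidean_space). min ((norm z)\<^sup>2 / r\<^sup>2) 1 / norm z powr (real DIM('a) + 2 * s)"
  shows "integrable lborel (\<Phi> r)" and "integral\<^sup>L lborel (\<Phi> r) = r powr (- 2 * s) * integral\<^sup>L lborel (\<Phi> 1)"
proof -
  let ?n = "DIM('a)"
  let ?p = "real ?n + 2 * s"
  have [measurable]: "\<Phi> r \<in> borel_measurable borel" for r unfolding \<Phi>_def by measurable
  have i1: "integrable lborel (\<Phi> 1)"
    using integrable_fractional_kernel[OF s] unfolding \<Phi>_def by simp
  have sc: "r ^ ?n * \<Phi> r (r *\<^sub>R z) = r powr (- 2 * s) * \<Phi> 1 z" for z
  proof -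
    have "r ^ ?n / r powr ?p = r powr (- 2 * s)"
      using r by (simp add: powr_realpow[symmetric] powr_diff[symmetric])
    moreover have "min ((r * norm z)\<^sup>2 / r\<^sup>2) 1 = min ((norm z)\<^sup>2) 1"
      using r by (simp add: power_mult_distrib)
    ultimately show ?thesis
      using r by (simp add: \<Phi>_def powr_mult field_simps)
  qed
  have L: "lborel = density (distr lborel borel (\<lambda>x::'a. r *\<^sub>R x)) (\<lambda>_. ennreal (r ^ ?n))"
    using lborel_affine[of r "0::'a"] r by simp
  have "integrable lborel (\<lambda>z. r ^ ?n *\<^sub>R \<Phi> r (r *\<^sub>R z))"
    using i1 by (simp add: sc)
  then show "integrable lborel (\<Phi> r)"
    using r by (subst L, subst integrable_density) (auto simp: integrable_distr_eq)
  have "integral\<^sup>L lborel (\<Phi> r) = (LINT z|lborel. r ^ ?n *\<^sub>R \<Phi> r (r *\<^sub>R z))"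
    using r by (subst L, subst integral_density) (auto simp: integral_distr)
  also have "\<dots> = r powr (- 2 * s) * integral\<^sup>L lborel (\<Phi> 1)"
    by (simp add: sc)
  finally show "integral\<^sup>L lborel (\<Phi> r) = r powr (- 2 * s) * integral\<^sup>L lborel (\<Phi> 1)" .
qed

section \<open>Reflections and the Lebesgue measure\<close>

lemma lborel_measure_preserving:
  fixes T :: "'a::euclidean_space \<Rightarrow> 'a" and f :: "'a \<Rightarrow> real"
  assumes T: "distr lborel borel T = lborel" and [measurable]: "T \<in> borel_measurable borel" "f \<in> borel_measurable borel"
  shows "integrable lborel (\<lambda>z. f (T z)) \<longleftrightarrow> integrable lborel f"
    and "(LINT z|lborel. f (T z)) = integral\<^sup>L lborel f"
proof -
  have "integrable (distr lborel borel T) f \<longleftrightarrow> integrable lborel (\<lambda>z. f (T z))"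
    by (rule integrable_distr_eq) auto
  then show "integrable lborel (\<lambda>z. f (T z)) \<longleftrightarrow> integrable lborel f" unfolding T by simp
  have "integral\<^sup>L (distr lborel borel T) f = (LINT z|lborel. f (T z))"
    by (rule integral_distr) auto
  then show "(LINT z|lborel. f (T z)) = integral\<^sup>L lborel f" unfolding T by simp
qed

lemma distr_lborel_uminus: "distr lborel borel uminus = (lborel :: 'a::euclidean_space measure)"
  using lborel_affine[of "-1" "0::'a"] by (simp add: density_1 uminus_add_conv_diff[symmetric])

text \<open>The reflection across the hyperplane of all \<open>x\<close> with \<open>x $ k = \<mu>\<close>. The case \<open>\<mu> = 0\<close> is its linear
part.\<close>

definition reflect :: "'n::finite \<Rightarrow> real \<Rightarrow> real ^ 'n \<Rightarrow> real ^ 'n" where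
  "reflect k \<mu> x = x + (2 * (\<mu> - x $ k)) *\<^sub>R axis k 1"

lemma reflect_nth: "reflect k \<mu> x $ i = (if i = k then 2 * \<mu> - x $ k else x $ i)"
  by (auto simp: reflect_def axis_def)

lemma reflect_reflect [simp]: "reflect k \<mu> (reflect k \<mu> x) = x"
  by (auto simp: vec_eq_iff reflect_nth)

lemma reflect_add: "reflect k \<mu> (x + z) = reflect k \<mu> x + reflect k 0 z"
  by (auto simp: vec_eq_iff reflect_nth)

lemma reflect_diff: "reflect k \<mu> (x - z) = reflect k \<mu> x - reflect k 0 z"
  by (auto simp: vec_eq_iff reflect_nth)

lemma norm_reflect_0 [simp]: "norm (reflect k 0 z) = norm z"
  by (simp add: norm_vec_def reflect_nth L2_set_def if_distrib[of "\<lambda>x. x\<^sup>2"] cong: if_cong)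
    (metis (no_types, lifting) power2_minus)

lemma continuous_reflect [continuous_intros]:
  "continuous_on S f \<Longrightarrow> continuous_on S (\<lambda>x. reflect k \<mu> (f x))"
  unfolding reflect_def by (intro continuous_intros)

lemma reflect_measurable [measurable]: "reflect k \<mu> \<in> borel_measurable borel"
  by (intro borel_measurable_continuous_onI continuous_reflect continuous_on_id)

lemma distr_lborel_reflect: "distr lborel borel (reflect k \<mu>) = (lborel :: (real ^ 'n::finite) measure)"
proof -
  let ?b = "axis k 1 :: real ^ 'n"
  define c where "c j = (if j = ?b then -1 else 1 :: real)" for j
  have b: "?b \<in> Basis" by (simp add: axis_in_Basis_iff)
  have "(\<Sum>j\<in>Basis. (c j * (x \<bullet> j)) *\<^sub>R j) = x - (2 * x $ k) *\<^sub>R ?b" for x :: "real ^ 'n"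
  proof -
    have "(\<Sum>j\<in>Basis. (c j * (x \<bullet> j)) *\<^sub>R j)
        = (\<Sum>j\<in>Basis. (x \<bullet> j) *\<^sub>R j - (if j = ?b then (2 * (x \<bullet> j)) *\<^sub>R j else 0))"
    proof (intro sum.cong refl)
      fix j :: "real ^ 'n"
      show "(c j * (x \<bullet> j)) *\<^sub>R j = (x \<bullet> j) *\<^sub>R j - (if j = ?b then (2 * (x \<bullet> j)) *\<^sub>R j else 0)"
        by (simp add: c_def vec_eq_iff algebra_simps)
    qed
    also have "\<dots> = x - (2 * x $ k) *\<^sub>R ?b"
      using b by (simp add: sum_subtractf euclidean_representation sum.delta inner_axis)
    finally show ?thesis .
  qed
  moreover have "(\<Prod>j\<in>Basis. \<bar>c j\<bar>) = 1" by (intro prod.neutral) (auto simp: c_def)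
  moreover have "lborel = density (distr lborel borel (\<lambda>x. (2 * \<mu>) *\<^sub>R ?b + (\<Sum>j\<in>Basis. (c j * (x \<bullet> j)) *\<^sub>R j)))
      (\<lambda>_. ennreal (\<Prod>j\<in>Basis. \<bar>c j\<bar>))"
    by (rule lborel_affine_euclidean) (auto simp: c_def)
  moreover have "(\<lambda>x. (2 * \<mu>) *\<^sub>R ?b + (x - (2 * x $ k) *\<^sub>R ?b)) = reflect k \<mu>"
    by (auto simp: reflect_def right_diff_distrib scaleR_left_diff_distrib)
  ultimately show ?thesis by (simp add: density_1)
qed

section \<open>The fractional Laplacian as an absolutely convergent integral\<close>

text \<open>Averaging the truncated integral over \<open>z\<close> and \<open>- z\<close> replaces first by second differences, which
are \<open>O(norm z ^ 2)\<close>. The principal value then is an ordinary absolutely convergent integral, by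
dominated convergence, and can be estimated pointwise under the integral sign.\<close>

lemma frac_laplacian_eq_second_difference:
  fixes v :: "real ^ 'n::finite \<Rightarrow> real" and x :: "real ^ 'n"
  assumes s: "0 < s" "s < 1" and v: "v \<in> C2_space" and cont: "continuous_on UNIV v"
    and bd: "\<And>y. \<bar>v y\<bar> \<le> M"
  defines "D \<equiv> \<lambda>z. (2 * v x - v (x + z) - v (x - z)) / norm z powr (real CARD('n) + 2 * s)"
  shows "integrable lborel D"
    and "frac_laplacian s v x = frac_laplacian_const (real CARD('n)) s * (integral\<^sup>L lborel D / 2)"
proof -
  define p where "p = real CARD('n) + 2 * s"
  define \<Phi> where "\<Phi> z = min ((norm z)\<^sup>2) 1 / norm z powr p" for z :: "real^'n"
  have \<Phi>: "integrable lborel \<Phi>"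
    using integrable_fractional_kernel[OF s, where 'a = "real^'n"] by (simp add: \<Phi>_def[abs_def] p_def)
  have [measurable]: "v \<in> borel_measurable borel"
    using cont by (rule borel_measurable_continuous_onI)
  have D_eq: "D z = (2 * v x - v (x + z) - v (x - z)) / norm z powr p" for z
    by (simp add: D_def p_def)
  have [measurable]: "D \<in> borel_measurable borel" unfolding D_def by measurable
  have M0: "0 \<le> M" using bd[of x] by linarith
  obtain C where C0: "0 \<le> C" and C: "\<And>z. norm z \<le> 1 \<Longrightarrow> \<bar>2 * v x - v (x + z) - v (x - z)\<bar> \<le> C * (norm z)\<^sup>2"
    using C2_space_second_difference_bound[OF v, of x] by metis
  define C' where "C' = max C (4 * M)"
  have D_le: "\<bar>D z\<bar> \<le> C' * \<Phi> z" for z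
  proof -
    have "\<bar>2 * v x - v (x + z) - v (x - z)\<bar> \<le> C' * min ((norm z)\<^sup>2) 1"
    proof (cases "norm z \<le> 1")
      case True
      then have "(norm z)\<^sup>2 \<le> 1" by (simp add: power_le_one)
      moreover have "C * (norm z)\<^sup>2 \<le> C' * (norm z)\<^sup>2" by (intro mult_right_mono) (auto simp: C'_def)
      ultimately show ?thesis using C[OF True] by (simp add: min_def)
    next
      case False
      then have "1 \<le> (norm z)\<^sup>2" by simp
      moreover have "\<bar>2 * v x - v (x + z) - v (x - z)\<bar> \<le> 4 * M"
        using bd[of x] bd[of "x + z"] bd[of "x - z"] by (simp add: abs_le_iff)
      ultimately show ?thesis by (simp add: C'_def)
    qed
    then show ?thesis
      by (simp add: D_eq \<Phi>_def abs_divide divide_right_mono flip: times_divide_eq_right)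
         (metis divide_right_mono powr_ge_zero times_divide_eq_right)
  qed
  show iD: "integrable lborel D"
    by (rule Bochner_Integration.integrable_bound[OF integrable_mult_right[OF \<Phi>, of C']])
       (use D_le order_trans[OF D_le abs_ge_self] in auto)
  define T where "T \<epsilon> = (LINT y : - ball x \<epsilon> | lebesgue. (v x - v y) / norm (x - y) powr p)" for \<epsilon>
  have T_eq: "T \<epsilon> = (LINT z|lborel. indicator (- ball 0 \<epsilon>) z * D z) / 2" if e: "0 < \<epsilon>" for \<epsilon>
  proof -
    define h where "h z = indicator (- ball 0 \<epsilon>) z * ((v x - v (x + z)) / norm z powr p)" for z :: "real^'n"
    have [measurable]: "h \<in> borel_measurable borel" unfolding h_def by measurable
    have hb: "\<bar>h z\<bar> \<le> 2 * M / min (\<epsilon>\<^sup>2) 1 * \<Phi> z" for z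
    proof (cases "norm z < \<epsilon>")
      case True then show ?thesis using M0 e by (simp add: h_def \<Phi>_def)
    next
      case False
      then have "\<epsilon>\<^sup>2 \<le> (norm z)\<^sup>2" using e by (intro power_mono) auto
      then have "min (\<epsilon>\<^sup>2) 1 \<le> min ((norm z)\<^sup>2) 1" by auto
      then have "2 * M * 1 \<le> 2 * M * (min ((norm z)\<^sup>2) 1 / min (\<epsilon>\<^sup>2) 1)"
        using M0 e by (intro mult_left_mono) auto
      moreover have "\<bar>v x - v (x + z)\<bar> \<le> 2 * M"
        using bd[of x] bd[of "x + z"] by (simp add: abs_le_iff)
      ultimately have "\<bar>v x - v (x + z)\<bar> \<le> 2 * M / min (\<epsilon>\<^sup>2) 1 * min ((norm z)\<^sup>2) 1" by simp
      then have "\<bar>v x - v (x + z)\<bar> / norm z powr p \<le> 2 * M / min (\<epsilon>\<^sup>2) 1 * min ((norm z)\<^sup>2) 1 / norm z powr p"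
        by (rule divide_right_mono) simp
      then show ?thesis using False by (simp add: h_def \<Phi>_def)
    qed
    have ih: "integrable lborel h"
    proof (rule Bochner_Integration.integrable_bound[OF integrable_mult_right[OF \<Phi>, of "2 * M / min (\<epsilon>\<^sup>2) 1"]])
      show "AE z in lborel. norm (h z) \<le> norm (2 * M / min (\<epsilon>\<^sup>2) 1 * \<Phi> z)"
        using hb by (intro AE_I2) (metis abs_ge_self order_trans real_norm_def)
    qed measurable
    have m: "integrable lborel (\<lambda>z. h (- z))" "(LINT z|lborel. h (- z)) = integral\<^sup>L lborel h"
      using lborel_measure_preserving[OF distr_lborel_uminus, of h] ih by auto
    have "T \<epsilon> = (LINT y|lborel. indicator (- ball x \<epsilon>) y * ((v x - v y) / norm (x - y) powr p))"
      unfolding T_def set_lebesgue_integral_def by (subst integral_completion) auto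
    also have "\<dots> = (LINT z|lborel. indicator (- ball x \<epsilon>) (x + z) * ((v x - v (x + z)) / norm (x - (x + z)) powr p))"
      by (rule lborel_measure_preserving(2)[OF lborel_distr_plus, symmetric]) auto
    also have "\<dots> = integral\<^sup>L lborel h"
      by (intro Bochner_Integration.integral_cong) (auto simp: h_def indicator_def dist_norm)
    finally have "2 * T \<epsilon> = integral\<^sup>L lborel h + (LINT z|lborel. h (- z))" by (simp add: m)
    also have "\<dots> = (LINT z|lborel. h z + h (- z))"
      using ih m by simp
    also have "\<dots> = (LINT z|lborel. indicator (- ball 0 \<epsilon>) z * D z)"
      by (intro Bochner_Integration.integral_cong)
         (auto simp: h_def indicator_def D_eq diff_divide_distrib add_divide_distrib)
    finally show ?thesis by simp
  qed
  have "((\<lambda>t. LINT z|lborel. indicator (- ball 0 (inverse t)) z * D z) \<longlongrightarrow> integral\<^sup>L lborel D) at_top"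
  proof (rule integral_dominated_convergence_at_top[where w = "\<lambda>z. \<bar>D z\<bar>"])
    show "AE z in lborel. ((\<lambda>t. indicator (- ball 0 (inverse t)) z * D z) \<longlongrightarrow> D z) at_top"
    proof (rule AE_I2)
      fix z :: "real^'n"
      show "((\<lambda>t. indicator (- ball 0 (inverse t)) z * D z) \<longlongrightarrow> D z) at_top"
      proof (cases "z = 0")
        case True then show ?thesis by (simp add: D_def)
      next
        case False
        have "\<forall>\<^sub>F t in at_top. inverse (norm z) < t" by (rule eventually_gt_at_top)
        then have "\<forall>\<^sub>F t in at_top. indicator (- ball 0 (inverse t)) z * D z = D z"
        proof eventually_elim
          case (elim t)
          have "inverse t < inverse (inverse (norm z))"
            using elim False by (intro less_imp_inverse_less) auto
          then show ?case by (simp add: indicator_def)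
        qed
        then show ?thesis by (rule tendsto_eventually)
      qed
    qed
  qed (use iD in \<open>auto simp: indicator_def\<close>)
  then have "((\<lambda>\<epsilon>. LINT z|lborel. indicator (- ball 0 \<epsilon>) z * D z) \<longlongrightarrow> integral\<^sup>L lborel D) (at_right 0)"
    by (subst filterlim_at_right_to_top)
  then have "((\<lambda>\<epsilon>. (LINT z|lborel. indicator (- ball 0 \<epsilon>) z * D z) / 2) \<longlongrightarrow> integral\<^sup>L lborel D / 2) (at_right 0)"
    by (intro tendsto_divide tendsto_const) auto
  moreover have "\<forall>\<^sub>F \<epsilon> in at_right 0. (LINT z|lborel. indicator (- ball 0 \<epsilon>) z * D z) / 2 = T \<epsilon>"
    using T_eq by (auto simp: eventually_at_filter)
  ultimately have "(T \<longlongrightarrow> integral\<^sup>L lborel D / 2) (at_right 0)"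
    by (rule Lim_transform_eventually)
  then have "Lim (at_right 0) T = integral\<^sup>L lborel D / 2"
    by (intro tendsto_Lim) auto
  then show "frac_laplacian s v x = frac_laplacian_const (real CARD('n)) s * (integral\<^sup>L lborel D / 2)"
    by (simp add: frac_laplacian_def T_def[abs_def] p_def)
qed

section \<open>Comparison of time derivatives\<close>

lemma marchaud_kernel_mass:
  fixes \<alpha> T :: real
  assumes a: "0 < \<alpha>" "\<alpha> < 1" and T: "0 < T"
  shows "set_integrable lborel {0<..} (\<lambda>\<sigma>. min (\<sigma> / T) 1 / \<sigma> powr (1 + \<alpha>))"
    and "(LINT \<sigma>:{0<..}|lborel. min (\<sigma> / T) 1 / \<sigma> powr (1 + \<alpha>)) = T powr (- \<alpha>) * (1 / (1 - \<alpha>) + 1 / \<alpha>)"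
proof -
  define f where "f \<sigma> = min (\<sigma> / T) 1 / \<sigma> powr (1 + \<alpha>)" for \<sigma>
  define I1 where "I1 = T powr (- \<alpha>) / (1 - \<alpha>)"
  define I2 where "I2 = T powr (- \<alpha>) / \<alpha>"
  have [measurable]: "f \<in> borel_measurable borel" unfolding f_def by measurable
  have f0: "0 \<le> f x" if "0 < x" for x using that T by (simp add: f_def)
  have h1: "((\<lambda>x. x powr (- \<alpha>)) has_integral (T powr (- \<alpha> + 1) / (- \<alpha> + 1))) {0..T}"
    using has_integral_powr_from_0[of "-\<alpha>" T] a T by simp
  have "((\<lambda>x. x powr (- \<alpha>) / T) has_integral (T powr (- \<alpha> + 1) / (- \<alpha> + 1)) / T) {0..T}"
    by (rule has_integral_divide[OF h1])
  moreover have "(T powr (- \<alpha> + 1) / (- \<alpha> + 1)) / T = I1"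
    unfolding powr_add using T a by (simp add: I1_def field_simps)
  moreover have "x powr (- \<alpha>) / T = f x" if "x \<in> {0..T}" for x
  proof (cases "x = 0")
    case False
    then have "0 < x" "x \<le> T" using that by auto
    then have "f x = (x / T) / x powr (1 + \<alpha>)" using T by (simp add: f_def min_def)
    also have "\<dots> = x powr (- \<alpha>) / T" using \<open>0 < x\<close> by (simp add: powr_add powr_minus field_simps)
    finally show ?thesis by simp
  qed (use a in \<open>simp add: f_def\<close>)
  ultimately have f1: "(f has_integral I1) {0..T}"
    by (metis (mono_tags, lifting) has_integral_eq)
  have h2: "((\<lambda>x. x powr (- (1 + \<alpha>))) has_integral - (T powr (- (1 + \<alpha>) + 1)) / (- (1 + \<alpha>) + 1)) {T..}"
    using has_integral_powr_to_inf[of "-(1+\<alpha>)" T] a T by simp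
  moreover have "- (T powr (- (1 + \<alpha>) + 1)) / (- (1 + \<alpha>) + 1) = I2" by (simp add: I2_def)
  moreover have "x powr (- (1 + \<alpha>)) = f x" if "x \<in> {T..}" for x
    using that T by (simp only: f_def powr_minus_divide) simp
  ultimately have f2: "(f has_integral I2) {T..}"
    by (metis (mono_tags, lifting) has_integral_eq)
  have "(f has_integral (I1 + I2)) ({0..T} \<union> {T..})"
  proof (rule has_integral_Un[OF f1 f2])
    have "{0..T} \<inter> {T..} = {T}" using T by auto
    then show "negligible ({0..T} \<inter> {T..})" by simp
  qed
  moreover have "{0..T} \<union> {T..} = {0..}" using T by auto
  ultimately have f3: "(f has_integral (I1 + I2)) {0..}" by simp
  have f4: "(f has_integral (I1 + I2)) {0<..}"
  proof -
    have "negligible {x \<in> {0..} - {0<..}. f x \<noteq> 0}" by (rule negligible_subset[of "{0}"]) auto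
    moreover have "negligible {x \<in> {0<..} - {0..}. f x \<noteq> 0}" by (rule negligible_subset[of "{0}"]) auto
    ultimately show ?thesis using has_integral_spike_set_eq f3 by blast
  qed
  have "f absolutely_integrable_on {0<..}"
    using f4 f0 by (intro nonnegative_absolutely_integrable_1) auto
  then have si: "set_integrable lebesgue {0<..} f" .
  then show "set_integrable lborel {0<..} (\<lambda>\<sigma>. min (\<sigma> / T) 1 / \<sigma> powr (1 + \<alpha>))"
    unfolding f_def[symmetric] set_integrable_def by (subst (asm) integrable_completion) auto
  have "(LINT \<sigma>:{0<..}|lborel. f \<sigma>) = (LINT \<sigma>:{0<..}|lebesgue. f \<sigma>)"
    unfolding set_lebesgue_integral_def by (subst integral_completion) auto
  also have "\<dots> = I1 + I2"
    using set_lebesgue_integral_eq_integral(2)[OF si] f4 by (simp add: integral_unique)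
  finally show "(LINT \<sigma>:{0<..}|lborel. min (\<sigma> / T) 1 / \<sigma> powr (1 + \<alpha>)) = T powr (- \<alpha>) * (1 / (1 - \<alpha>) + 1 / \<alpha>)"
    unfolding f_def[symmetric] by (simp add: I1_def I2_def field_simps)
qed

lemma marchaud_eq:
  fixes v :: "real \<Rightarrow> real"
  assumes [measurable]: "v \<in> borel_measurable borel"
  shows "marchaud \<alpha> v t = \<alpha> / Gamma (1 - \<alpha>) * (LINT \<sigma>:{0<..}|lborel. (v t - v (t - \<sigma>)) / \<sigma> powr (1 + \<alpha>))"
proof -
  have "(LINT \<tau> : {..<t} | lebesgue. (v t - v \<tau>) / (t - \<tau>) powr (1 + \<alpha>))
      = (LINT \<tau>|lborel. indicator {..<t} \<tau> * ((v t - v \<tau>) / (t - \<tau>) powr (1 + \<alpha>)))"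
    unfolding set_lebesgue_integral_def by (subst integral_completion) auto
  also have "\<dots> = (LINT \<sigma>|lborel. indicator {..<t} (t + -1 * \<sigma>) * ((v t - v (t + -1 * \<sigma>)) / (t - (t + -1 * \<sigma>)) powr (1 + \<alpha>)))"
    by (subst lborel_integral_real_affine[where c = "-1" and t = t]) auto
  also have "\<dots> = (LINT \<sigma>:{0<..}|lborel. (v t - v (t - \<sigma>)) / \<sigma> powr (1 + \<alpha>))"
    unfolding set_lebesgue_integral_def by (intro Bochner_Integration.integral_cong) (auto simp: indicator_def)
  finally show ?thesis by (simp add: marchaud_def)
qed

text \<open>Near the singularity the increment is controlled by the continuous derivative, far away by the
bound on \<open>v\<close>.\<close>

lemma marchaud_integrable:
  fixes v :: "real \<Rightarrow> real"
  assumes a: "0 < \<alpha>" "\<alpha> < 1" and v: "v C1_differentiable_on UNIV" and bd: "\<And>t. \<bar>v t\<bar> \<le> M"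
  shows "set_integrable lborel {0<..} (\<lambda>\<sigma>. (v t - v (t - \<sigma>)) / \<sigma> powr (1 + \<alpha>))"
proof -
  obtain v' where v': "\<And>x. (v has_vector_derivative v' x) (at x)" and cv': "continuous_on UNIV v'"
    using v by (auto simp: C1_differentiable_on_def)
  have cont: "continuous_on UNIV v"
    using v' by (meson continuous_at_imp_continuous_on has_vector_derivative_continuous)
  then have [measurable]: "v \<in> borel_measurable borel" by (rule borel_measurable_continuous_onI)
  have "bounded (v' ` {t - 1..t})"
    by (intro compact_imp_bounded compact_continuous_image continuous_on_subset[OF cv']) auto
  then obtain B where "\<forall>x\<in>{t - 1..t}. \<bar>v' x\<bar> \<le> B" by (auto simp: bounded_iff)
  then have B: "\<bar>v' x\<bar> \<le> B" if "x \<in> {t - 1..t}" for x using that by blast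
  have M0: "0 \<le> M" using bd[of 0] by linarith
  define L where "L = max B (2 * M)"
  have le: "\<bar>v t - v (t - \<sigma>)\<bar> \<le> L * min (\<sigma> / 1) 1" if "0 < \<sigma>" for \<sigma>
  proof (cases "\<sigma> \<le> 1")
    case True
    have "norm (v t - v (t - \<sigma>)) \<le> B * norm (t - (t - \<sigma>))"
    proof (rule field_differentiable_bound[of "{t - 1..t}" v v'])
      show "(v has_field_derivative v' x) (at x within {t - 1..t})" for x
        using v'[of x] by (simp add: has_real_derivative_iff_has_vector_derivative has_vector_derivative_at_within)
    qed (use that True B in auto)
    then have "\<bar>v t - v (t - \<sigma>)\<bar> \<le> B * \<sigma>" using that by simp
    also have "\<dots> \<le> L * \<sigma>" using that by (auto simp: L_def intro: mult_right_mono)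
    finally show ?thesis using True by (simp add: min_def)
  next
    case False
    have "\<bar>v t - v (t - \<sigma>)\<bar> \<le> 2 * M" using bd[of t] bd[of "t - \<sigma>"] by (simp add: abs_le_iff)
    then show ?thesis using False by (simp add: L_def)
  qed
  show ?thesis
  proof (rule set_integrable_bound)
    show "set_integrable lborel {0<..} (\<lambda>\<sigma>. L * (min (\<sigma> / 1) 1 / \<sigma> powr (1 + \<alpha>)))"
      using marchaud_kernel_mass(1)[OF a, of 1] by (intro set_integrable_mult_right) auto
    show "set_borel_measurable lborel {0<..} (\<lambda>\<sigma>. (v t - v (t - \<sigma>)) / \<sigma> powr (1 + \<alpha>))"
      unfolding set_borel_measurable_def by measurable
    show "AE \<sigma> in lborel. \<sigma> \<in> {0<..} \<longrightarrow> norm ((v t - v (t - \<sigma>)) / \<sigma> powr (1 + \<alpha>))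
        \<le> norm (L * (min (\<sigma> / 1) 1 / \<sigma> powr (1 + \<alpha>)))"
    proof (intro AE_I2 impI)
      fix \<sigma> :: real assume "\<sigma> \<in> {0<..}"
      then have "\<bar>v t - v (t - \<sigma>)\<bar> \<le> \<bar>L * min (\<sigma> / 1) 1\<bar>" using le[of \<sigma>] by auto
      then have "\<bar>v t - v (t - \<sigma>)\<bar> / \<sigma> powr (1 + \<alpha>) \<le> \<bar>L * min (\<sigma> / 1) 1\<bar> / \<sigma> powr (1 + \<alpha>)"
        by (rule divide_right_mono) simp
      then show "norm ((v t - v (t - \<sigma>)) / \<sigma> powr (1 + \<alpha>)) \<le> norm (L * (min (\<sigma> / 1) 1 / \<sigma> powr (1 + \<alpha>)))"
        by (simp add: abs_mult)
    qed
  qed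
qed

text \<open>The left or Marchaud derivative at \<open>t\<close> of a function whose value at time \<open>t - \<sigma>\<close> lies
\<open>min (\<sigma> / T) 1\<close> below its value at \<open>t\<close>.\<close>

definition time_cutoff_rate :: "real \<Rightarrow> real \<Rightarrow> real" where
  "time_cutoff_rate \<alpha> T = (if \<alpha> = 1 then 1 / T
     else \<alpha> / Gamma (1 - \<alpha>) * (1 / (1 - \<alpha>) + 1 / \<alpha>) * T powr (- \<alpha>))"

text \<open>Both time derivatives look only at the past and are monotone in the increments
\<open>v t - v (t - \<sigma>)\<close>, so it suffices to compare those increments. With \<open>\<kappa> = 0\<close> this says that the
time derivative is nonpositive at a minimum. For \<open>\<alpha> < 1\<close> the difference of the two Marchaud
integrals may be taken because each of them converges absolutely.\<close>

lemma time_deriv_diff_le: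
  fixes v1 v2 :: "real \<Rightarrow> real"
  assumes a: "0 < \<alpha>" "\<alpha> \<le> 1"
    and v1: "v1 C1_differentiable_on UNIV" "\<And>t. \<bar>v1 t\<bar> \<le> M"
    and v2: "v2 C1_differentiable_on UNIV" "\<And>t. \<bar>v2 t\<bar> \<le> M"
    and T: "0 < T" and kap: "0 \<le> \<kappa>"
    and le: "\<And>\<sigma>. 0 < \<sigma> \<Longrightarrow> (v1 t - v2 t) - (v1 (t - \<sigma>) - v2 (t - \<sigma>)) \<le> \<kappa> * min (\<sigma> / T) 1"
  shows "time_deriv \<alpha> v1 t - time_deriv \<alpha> v2 t \<le>
    \<kappa> * time_cutoff_rate \<alpha> T"
proof (cases "\<alpha> = 1")
  case True
  have d: "v differentiable at t" if "v C1_differentiable_on UNIV" for v :: "real \<Rightarrow> real"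
    using that C1_differentiable_on_eq by auto
  define w where "w t = v1 t - v2 t" for t
  have dw: "(w has_real_derivative deriv v1 t - deriv v2 t) (at t)"
    unfolding w_def using d[OF v1(1)] d[OF v2(1)]
    by (intro DERIV_diff) (auto simp: DERIV_deriv_iff_real_differentiable)
  then have "((\<lambda>h. (w (t + h) - w t) / h) \<longlongrightarrow> deriv v1 t - deriv v2 t) (at 0)"
    by (simp add: DERIV_def)
  then have lim: "((\<lambda>h. (w (t + h) - w t) / h) \<longlongrightarrow> deriv v1 t - deriv v2 t) (at_left 0)"
    by (auto intro: filterlim_mono at_within_le_at)
  have "deriv v1 t - deriv v2 t \<le> \<kappa> / T"
  proof (rule tendsto_upperbound[OF lim])
    show "\<forall>\<^sub>F h in at_left 0. (w (t + h) - w t) / h \<le> \<kappa> / T"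
      unfolding eventually_at_filter
    proof (intro always_eventually allI impI)
      fix h :: real assume "h \<noteq> 0" "h \<in> {..<0}"
      then have h: "h < 0" by simp
      have "w t - w (t + h) \<le> \<kappa> * min (- h / T) 1" using le[of "- h"] h by (simp add: w_def)
      also have "\<dots> \<le> \<kappa> * (- h / T)" using kap by (intro mult_left_mono) auto
      finally show "(w (t + h) - w t) / h \<le> \<kappa> / T"
        using h T by (simp add: divide_le_eq field_simps)
    qed
  qed auto
  then show ?thesis using True by (simp add: time_deriv_def time_cutoff_rate_def)
next
  case False
  then have a1: "\<alpha> < 1" using a by simp
  have m: "v \<in> borel_measurable borel" if "v C1_differentiable_on UNIV" for v :: "real \<Rightarrow> real"
    using that by (intro borel_measurable_continuous_onI C1_differentiable_imp_continuous_on)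
  define I where "I v = (LINT \<sigma>:{0<..}|lborel. (v t - v (t - \<sigma>)) / \<sigma> powr (1 + \<alpha>))" for v :: "real \<Rightarrow> real"
  note i1 = marchaud_integrable[OF a(1) a1 v1, of t] and i2 = marchaud_integrable[OF a(1) a1 v2, of t]
  have "I v1 - I v2 = (LINT \<sigma>:{0<..}|lborel. (v1 t - v1 (t - \<sigma>)) / \<sigma> powr (1 + \<alpha>) - (v2 t - v2 (t - \<sigma>)) / \<sigma> powr (1 + \<alpha>))"
    unfolding I_def by (rule set_integral_diff(2)[OF i1 i2, symmetric])
  also have "\<dots> \<le> (LINT \<sigma>:{0<..}|lborel. \<kappa> * (min (\<sigma> / T) 1 / \<sigma> powr (1 + \<alpha>)))"
  proof (rule set_integral_mono)
    show "set_integrable lborel {0<..} (\<lambda>\<sigma>. (v1 t - v1 (t - \<sigma>)) / \<sigma> powr (1 + \<alpha>) - (v2 t - v2 (t - \<sigma>)) / \<sigma> powr (1 + \<alpha>))"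
      by (rule set_integral_diff(1)[OF i1 i2])
    show "set_integrable lborel {0<..} (\<lambda>\<sigma>. \<kappa> * (min (\<sigma> / T) 1 / \<sigma> powr (1 + \<alpha>)))"
      using marchaud_kernel_mass(1)[OF a(1) a1 T] by (intro set_integrable_mult_right) auto
    fix \<sigma> :: real assume "\<sigma> \<in> {0<..}"
    then have "((v1 t - v2 t) - (v1 (t - \<sigma>) - v2 (t - \<sigma>))) / \<sigma> powr (1 + \<alpha>) \<le> \<kappa> * min (\<sigma> / T) 1 / \<sigma> powr (1 + \<alpha>)"
      using le by (intro divide_right_mono) auto
    then show "(v1 t - v1 (t - \<sigma>)) / \<sigma> powr (1 + \<alpha>) - (v2 t - v2 (t - \<sigma>)) / \<sigma> powr (1 + \<alpha>)
        \<le> \<kappa> * (min (\<sigma> / T) 1 / \<sigma> powr (1 + \<alpha>))"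
      by (simp add: diff_divide_distrib)
  qed
  also have "\<dots> = \<kappa> * (T powr (- \<alpha>) * (1 / (1 - \<alpha>) + 1 / \<alpha>))"
    by (simp only: set_integral_mult_right marchaud_kernel_mass(2)[OF a(1) a1 T])
  finally have le': "I v1 - I v2 \<le> \<kappa> * (T powr (- \<alpha>) * (1 / (1 - \<alpha>) + 1 / \<alpha>))" .
  have "0 \<le> \<alpha> / Gamma (1 - \<alpha>)" using a a1 by (simp add: Gamma_real_pos less_imp_le)
  note le'' = mult_left_mono[OF le' this]
  have "time_deriv \<alpha> v1 t - time_deriv \<alpha> v2 t = \<alpha> / Gamma (1 - \<alpha>) * (I v1 - I v2)"
    unfolding right_diff_distrib using False
    by (simp add: time_deriv_def marchaud_eq[OF m[OF v1(1)]] marchaud_eq[OF m[OF v2(1)]] I_def)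
  also note le''
  also have "\<alpha> / Gamma (1 - \<alpha>) * (\<kappa> * (T powr (- \<alpha>) * (1 / (1 - \<alpha>) + 1 / \<alpha>)))
      = \<kappa> * (\<alpha> / Gamma (1 - \<alpha>) * (1 / (1 - \<alpha>) + 1 / \<alpha>) * T powr (- \<alpha>))"
    by (simp only: mult_ac)
  finally show ?thesis using False by (simp only: time_cutoff_rate_def if_False)
qed

lemma time_error_small:
  fixes \<alpha> \<epsilon> :: real
  assumes a: "0 < \<alpha>" "\<alpha> \<le> 1" and e: "0 < \<epsilon>"
  obtains T where "0 < T"
    "time_cutoff_rate \<alpha> T \<le> \<epsilon>"
proof -
  define c where "c = (if \<alpha> = 1 then 1 else \<alpha> / Gamma (1 - \<alpha>) * (1 / (1 - \<alpha>) + 1 / \<alpha>))"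
  have "((\<lambda>T. c * T powr (- \<alpha>)) \<longlongrightarrow> c * 0) at_top"
    using a by (intro tendsto_mult tendsto_const tendsto_neg_powr filterlim_ident) auto
  then have "\<forall>\<^sub>F T in at_top. c * T powr (- \<alpha>) < \<epsilon>"
    using e by (intro order_tendstoD(2)) auto
  then have "\<forall>\<^sub>F T in at_top. c * T powr (- \<alpha>) < \<epsilon> \<and> 0 < T"
    using eventually_gt_at_top[of "0::real"] by eventually_elim auto
  then obtain T where T: "c * T powr (- \<alpha>) < \<epsilon>" "0 < T"
    by (metis (mono_tags, lifting) eventually_happens trivial_limit_at_top_linorder)
  show ?thesis
    by (rule that[of T]) (use T in \<open>auto simp: time_cutoff_rate_def c_def powr_minus_divide split: if_splits\<close>)
qed

section \<open>The maximum principle for antisymmetric functions\<close>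

text \<open>The maximum principle for antisymmetric functions, in quantitative form. With
\<open>N z = v (x + z) - v x\<close> and \<open>K\<close> the kernel, the integral in question is \<open>- 2\<close> times the integral of \<open>N K\<close>.
The negative values of \<open>v\<close> beyond the plane are no obstacle: pairing \<open>z\<close> with its mirror image \<open>\<rho> z\<close>
gives \<open>N z * K z + N (\<rho> z) * K (\<rho> z) = N z * (K z - K (\<rho> z)) - 2 * v x * K (\<rho> z)\<close>, where the first
term is nonnegative because \<open>\<rho> z\<close> is the farther point, and the second gains a positive amount. On
the ball that touches the plane, \<open>K (\<rho> z)\<close> is at least \<open>(3 * d) powr - p\<close>, with \<open>p\<close> the
exponent of the kernel and \<open>d\<close> the distance of \<open>x\<close> to the plane; hence the power \<open>- 2 * s\<close> of \<open>d\<close> in the bound.\<close>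

lemma antisymmetric_minimum_integral_le:
  fixes v :: "real ^ 'n::finite \<Rightarrow> real" and x :: "real ^ 'n"
  assumes s: "0 < s" "s < 1"
    and [measurable]: "v \<in> borel_measurable borel" and bd: "\<And>y. \<bar>v y\<bar> \<le> M"
    and anti: "\<And>y. v (reflect k \<mu> y) = - v y"
    and x: "x $ k < \<mu>" and min: "\<And>y. y $ k < \<mu> \<Longrightarrow> v x \<le> v y" and neg: "v x \<le> 0"
    and int: "integrable lborel (\<lambda>z. (2 * v x - v (x + z) - v (x - z)) / norm z powr (real CARD('n) + 2 * s))"
  shows "(LINT z|lborel. (2 * v x - v (x + z) - v (x - z)) / norm z powr (real CARD('n) + 2 * s))
     \<le> 2 * v x * (unit_ball_vol (real CARD('n)) * 3 powr - (real CARD('n) + 2 * s)) * (\<mu> - x $ k) powr (- 2 * s)"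
proof -
  define p where "p = real CARD('n) + 2 * s"
  define d where "d = \<mu> - x $ k"
  define N where "N z = v (x + z) - v x" for z
  define NK where "NK z = N z / norm z powr p" for z
  define D where "D z = (2 * v x - v (x + z) - v (x - z)) / norm z powr p" for z
  define \<Phi> where "\<Phi> z = min ((norm z)\<^sup>2) 1 / norm z powr p" for z :: "real^'n"
  define \<rho> where "\<rho> = (reflect k d :: real^'n \<Rightarrow> _)"
  have p0: "0 < p" using s by (simp add: p_def add_nonneg_pos)
  have d0: "0 < d" using x by (simp add: d_def)
  have \<Phi>: "integrable lborel \<Phi>"
    using integrable_fractional_kernel[OF s, where 'a = "real^'n"] by (simp add: \<Phi>_def[abs_def] p_def)
  have iD: "integrable lborel D" using int by (simp add: D_def[abs_def] p_def)
  have [measurable]: "NK \<in> borel_measurable borel" "\<rho> \<in> borel_measurable borel"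
    unfolding NK_def N_def \<rho>_def by measurable
  have M0: "0 \<le> M" using bd[of x] by linarith
  have N_nonneg: "0 \<le> N z" if "z $ k < d" for z
    using min[of "x + z"] that by (simp add: N_def d_def)
  have N_rho: "N (\<rho> z) = - N z - 2 * v x" for z
  proof -
    have "x + \<rho> z = reflect k \<mu> (x + z)" by (auto simp: vec_eq_iff \<rho>_def reflect_nth d_def)
    then show ?thesis by (simp add: N_def anti)
  qed
  have D_eq: "D z = - (NK z + NK (- z))" for z
    by (simp add: D_def NK_def N_def add_divide_distrib diff_divide_distrib)
  (* In the ball that touches the plane both N z and N (- z) are nonnegative, so the integrable
     second difference controls each of them; this makes NK itself integrable. *)
  have bound: "\<bar>NK z\<bar> \<le> \<bar>D z\<bar> + 2 * M / min (d\<^sup>2) 1 * \<Phi> z" for z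
  proof (cases "norm z < d")
    case True
    then have "z $ k < d" "(- z) $ k < d" using component_le_norm_cart[of z k] by (auto simp: abs_le_iff)
    then have "0 \<le> NK z" "0 \<le> NK (- z)" using N_nonneg by (auto simp: NK_def)
    then have "\<bar>NK z\<bar> \<le> \<bar>D z\<bar>" by (simp add: D_eq)
    moreover have "0 \<le> 2 * M / min (d\<^sup>2) 1 * \<Phi> z" using M0 by (simp add: \<Phi>_def)
    ultimately show ?thesis by linarith
  next
    case False
    then have "d\<^sup>2 \<le> (norm z)\<^sup>2" using d0 by (intro power_mono) auto
    then have "min (d\<^sup>2) 1 \<le> min ((norm z)\<^sup>2) 1" by auto
    then have "2 * M * 1 \<le> 2 * M * (min ((norm z)\<^sup>2) 1 / min (d\<^sup>2) 1)"
      using M0 d0 by (intro mult_left_mono) auto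
    moreover have "\<bar>N z\<bar> \<le> 2 * M"
      using bd[of x] bd[of "x + z"] by (simp add: abs_le_iff N_def)
    ultimately have "\<bar>N z\<bar> \<le> 2 * M / min (d\<^sup>2) 1 * min ((norm z)\<^sup>2) 1" by simp
    then have "\<bar>N z\<bar> / norm z powr p \<le> 2 * M / min (d\<^sup>2) 1 * min ((norm z)\<^sup>2) 1 / norm z powr p"
      by (rule divide_right_mono) simp
    then have "\<bar>NK z\<bar> \<le> 2 * M / min (d\<^sup>2) 1 * \<Phi> z" by (simp add: NK_def \<Phi>_def)
    then show ?thesis by linarith
  qed
  have iNK: "integrable lborel NK"
  proof (rule Bochner_Integration.integrable_bound)
    show "integrable lborel (\<lambda>z. \<bar>D z\<bar> + 2 * M / min (d\<^sup>2) 1 * \<Phi> z)" using iD \<Phi> by auto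
    show "AE z in lborel. norm (NK z) \<le> norm (\<bar>D z\<bar> + 2 * M / min (d\<^sup>2) 1 * \<Phi> z)"
      using bound by (intro AE_I2) (metis abs_ge_self order_trans real_norm_def)
  qed measurable
  have um: "integrable lborel (\<lambda>z. NK (- z))" "(LINT z|lborel. NK (- z)) = integral\<^sup>L lborel NK"
    using lborel_measure_preserving[OF distr_lborel_uminus, of NK] iNK by auto
  have rm: "integrable lborel (\<lambda>z. NK (\<rho> z))" "(LINT z|lborel. NK (\<rho> z)) = integral\<^sup>L lborel NK"
    using lborel_measure_preserving[of \<rho> NK] iNK distr_lborel_reflect[of k d] by (auto simp: \<rho>_def)
  have "integral\<^sup>L lborel D = (LINT z|lborel. - (NK z + NK (- z)))" by (simp add: D_eq[abs_def])
  also have "\<dots> = - (2 * integral\<^sup>L lborel NK)" using iNK um by simp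
  also have "2 * integral\<^sup>L lborel NK = (LINT z|lborel. NK z + NK (\<rho> z))" using iNK rm by simp
  finally have ID: "integral\<^sup>L lborel D = - (LINT z|lborel. NK z + NK (\<rho> z))" .
  define c where "c = - 2 * v x * (3 * d) powr - p"
  have c0: "0 \<le> c" using neg by (simp add: c_def mult_nonpos_nonneg)
  have rr: "\<rho> (\<rho> z) = z" for z by (simp add: \<rho>_def)
  have pt: "c * indicator (ball 0 d) z \<le> NK z + NK (\<rho> z)" if z: "z $ k < d" for z
  proof -
    have "(norm z)\<^sup>2 \<le> (norm (\<rho> z))\<^sup>2"
    proof -
      have "(norm (\<rho> z))\<^sup>2 - (norm z)\<^sup>2 = 4 * d * (d - z $ k)"
      proof -
        have "(norm (\<rho> z))\<^sup>2 = (norm z)\<^sup>2 + (2 * (d - z $ k))\<^sup>2 + 2 * (2 * (d - z $ k)) * z $ k"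
          unfolding \<rho>_def reflect_def power2_norm_eq_inner
          by (simp add: inner_add_left inner_add_right inner_axis inner_axis' power2_eq_square algebra_simps)
        then show ?thesis by (simp add: power2_eq_square algebra_simps)
      qed
      also have "\<dots> \<ge> 0" using z d0 by simp
      finally show ?thesis by simp
    qed
    then have nle: "norm z \<le> norm (\<rho> z)" by (simp add: power2_le_iff_abs_le)
    have "\<rho> z $ k > d" using z by (simp add: \<rho>_def reflect_nth)
    then have rpos: "0 < norm (\<rho> z)" using d0 by auto
    have "0 \<le> N z * (1 / norm z powr p - 1 / norm (\<rho> z) powr p)"
    proof (cases "z = 0")
      case True then show ?thesis by (simp add: N_def)
    next
      case False
      have "1 / norm (\<rho> z) powr p \<le> 1 / norm z powr p"
        using False nle p0 rpos by (intro divide_left_mono powr_mono2 mult_pos_pos) auto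
      then show ?thesis using N_nonneg[OF z] by simp
    qed
    then have low: "- 2 * v x / norm (\<rho> z) powr p \<le> NK z + NK (\<rho> z)"
      by (simp add: NK_def N_rho algebra_simps diff_divide_distrib add_divide_distrib)
    show ?thesis
    proof (cases "norm z < d")
      case True
      have "\<rho> z = - reflect k 0 (- z) + (2 * d) *\<^sub>R axis k 1"
        by (auto simp: vec_eq_iff \<rho>_def reflect_nth axis_def)
      then have "norm (\<rho> z) \<le> norm z + 2 * d"
        using norm_triangle_ineq[of "- reflect k 0 (- z)" "(2 * d) *\<^sub>R axis k 1"] d0 by simp
      then have le3: "norm (\<rho> z) \<le> 3 * d" using True by simp
      have "c = - 2 * v x / (3 * d) powr p" by (simp add: c_def powr_minus_divide)
      also have "\<dots> \<le> - 2 * v x / norm (\<rho> z) powr p"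
        using rpos le3 p0 neg d0 by (intro divide_left_mono powr_mono2 mult_pos_pos) auto
      finally show ?thesis using low True by simp
    next
      case False
      have "0 \<le> - 2 * v x / norm (\<rho> z) powr p" using neg by (simp add: divide_nonpos_nonneg)
      with low False show ?thesis by simp
    qed
  qed
  have pt': "c * indicator (ball 0 d) z \<le> NK z + NK (\<rho> z)" for z
  proof -
    have out: "indicator (ball 0 d) z = (0::real)" if "d \<le> z $ k"
      using that component_le_norm_cart[of z k] by (simp add: indicator_def)
    consider "z $ k < d" | "d < z $ k" | "z $ k = d" by linarith
    then show ?thesis
    proof cases
      case 1 then show ?thesis by (rule pt)
    next
      case 2
      then have "\<rho> z $ k < d" by (simp add: \<rho>_def reflect_nth)
      from pt[OF this] have "c * indicator (ball 0 d) (\<rho> z) \<le> NK (\<rho> z) + NK z" by (simp add: rr)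
      moreover have "0 \<le> c * indicator (ball 0 d) (\<rho> z)" using c0 by simp
      ultimately show ?thesis using 2 out by simp
    next
      case 3
      then have r: "\<rho> z = z" by (auto simp: vec_eq_iff \<rho>_def reflect_nth)
      then have "N z = - v x" using N_rho[of z] by simp
      then show ?thesis using r 3 out neg by (simp add: NK_def divide_nonpos_nonneg)
    qed
  qed
  have ib: "integrable lborel (indicator (ball (0::real^'n) d) :: _ \<Rightarrow> real)"
    using d0 by (simp add: integrable_indicator_iff emeasure_ball)
  have "c * measure lborel (ball (0::real^'n) d) = (LINT z|lborel. c * indicator (ball (0::real^'n) d) z)"
    by simp
  also have "\<dots> \<le> (LINT z|lborel. NK z + NK (\<rho> z))"
    using ib iNK rm pt' by (intro integral_mono) auto
  finally have fin: "integral\<^sup>L lborel D \<le> - (c * measure lborel (ball (0::real^'n) d))" using ID by simp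
  have vol: "measure lborel (ball (0::real^'n) d) = unit_ball_vol (real CARD('n)) * d powr real CARD('n)"
    using d0 by (simp add: content_ball powr_realpow)
  have scale: "(3 * d) powr - p * d powr real CARD('n) = 3 powr - p * d powr (- 2 * s)"
  proof -
    have "(3 * d) powr - p = 3 powr - p * d powr - p" using d0 by (simp add: powr_mult)
    moreover have "d powr - p * d powr real CARD('n) = d powr (- 2 * s)"
      unfolding powr_add[symmetric] by (simp add: p_def)
    ultimately show ?thesis by simp
  qed
  have "- (c * measure lborel (ball (0::real^'n) d))
      = 2 * v x * (unit_ball_vol (real CARD('n)) * ((3 * d) powr - p * d powr real CARD('n)))"
    unfolding c_def vol by simp
  also have "\<dots> = 2 * v x * (unit_ball_vol (real CARD('n)) * 3 powr - p) * d powr (- 2 * s)"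
    unfolding scale by simp
  finally have "- (c * measure lborel (ball (0::real^'n) d))
      = 2 * v x * (unit_ball_vol (real CARD('n)) * 3 powr - p) * d powr (- 2 * s)" .
  with fin show ?thesis by (simp add: D_def[abs_def] p_def d_def)
qed

text \<open>The perturbation in space. As the minimum of a paraboloid and a constant it is semiconcave, so that
its second differences have explicit upper bounds in spite of the kink at the rim.\<close>

definition well :: "real ^ 'n::finite \<Rightarrow> real \<Rightarrow> real ^ 'n \<Rightarrow> real" where
  "well x0 r y = min ((norm (y - x0))\<^sup>2 / r\<^sup>2) 1 - 1"

lemma well_range: "- 1 \<le> well x0 r y" "well x0 r y \<le> 0"
  by (auto simp: well_def)

lemma well_outside: "0 < r \<Longrightarrow> r \<le> norm (y - x0) \<Longrightarrow> well x0 r y = 0"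
  by (auto simp: well_def min_def power_mono)

lemma well_le: "well x0 r y \<le> (norm (y - x0))\<^sup>2 / r\<^sup>2 - 1"
  by (simp add: well_def)

lemma well_inside: "0 < r \<Longrightarrow> norm (y - x0) \<le> r \<Longrightarrow> well x0 r y = (norm (y - x0))\<^sup>2 / r\<^sup>2 - 1"
  by (simp add: well_def power_mono)

lemma continuous_on_well [continuous_intros]:
  "continuous_on S f \<Longrightarrow> 0 < r \<Longrightarrow> continuous_on S (\<lambda>x. well x0 r (f x))"
  unfolding well_def by (intro continuous_intros) auto

lemma well_measurable [measurable]: "well x0 r \<in> borel_measurable borel"
  unfolding well_def by measurable

lemma norm_parallelogram: "(norm (a + z))\<^sup>2 + (norm (a - z))\<^sup>2 = 2 * (norm a)\<^sup>2 + 2 * (norm (z :: 'a::real_inner))\<^sup>2"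
  by (simp add: power2_norm_eq_inner inner_add_left inner_add_right inner_diff_left inner_diff_right inner_commute)

lemma well_second_difference_le:
  assumes r: "0 < r" and x: "norm (x - x0) < r"
  shows "well x0 r (x + z) + well x0 r (x - z) - 2 * well x0 r x \<le> 2 * min ((norm z)\<^sup>2 / r\<^sup>2) 1"
proof -
  have "well x0 r (x + z) + well x0 r (x - z)
      \<le> ((norm (x - x0 + z))\<^sup>2 + (norm (x - x0 - z))\<^sup>2) / r\<^sup>2 - 2"
    using well_le[of x0 r "x + z"] well_le[of x0 r "x - z"] by (simp add: algebra_simps add_divide_distrib)
  also have "\<dots> = 2 * well x0 r x + 2 * ((norm z)\<^sup>2 / r\<^sup>2)"
    unfolding norm_parallelogram using well_inside[OF r, of x x0] x by (simp add: add_divide_distrib algebra_simps)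
  finally have 1: "well x0 r (x + z) + well x0 r (x - z) - 2 * well x0 r x \<le> 2 * ((norm z)\<^sup>2 / r\<^sup>2)" by simp
  have "well x0 r (x + z) + well x0 r (x - z) - 2 * well x0 r x \<le> 2"
    using well_range[of x0 r x] well_range[of x0 r "x + z"] well_range[of x0 r "x - z"] by linarith
  with 1 show ?thesis by (simp add: min_def)
qed

text \<open>Inside the rim the well is exactly quadratic on a small ball around \<open>x\<close>. The integral converges,
but with a bound that degenerates towards the rim; uniform upper bounds come from
\<open>well_second_difference_le\<close>.\<close>

lemma well_second_difference_integrable:
  fixes x x0 :: "real ^ 'n::finite"
  assumes s: "0 < s" "s < 1" and r: "0 < r" and x: "norm (x - x0) < r"
  shows "integrable lborel (\<lambda>z. (2 * well x0 r x - well x0 r (x + z) - well x0 r (x - z)) / norm z powr (real CARD('n) + 2 * s))"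
proof -
  define p where "p = real CARD('n) + 2 * s"
  define \<delta> where "\<delta> = r - norm (x - x0)"
  define S where "S z = 2 * well x0 r x - well x0 r (x + z) - well x0 r (x - z)" for z
  have d0: "0 < \<delta>" and dr: "\<delta> \<le> r" using x by (auto simp: \<delta>_def)
  have le: "\<bar>S z\<bar> \<le> 2 * min ((norm z)\<^sup>2 / \<delta>\<^sup>2) 1" for z
  proof (cases "norm z < \<delta>")
    case True
    then have "norm (x - x0 + z) \<le> r" "norm (x - x0 - z) \<le> r"
      using norm_triangle_ineq[of "x - x0" z] norm_triangle_ineq4[of "x - x0" z] by (auto simp: \<delta>_def)
    moreover have e: "x + z - x0 = x - x0 + z" "x - z - x0 = x - x0 - z" by auto
    ultimately have "well x0 r (x + z) = (norm (x - x0 + z))\<^sup>2 / r\<^sup>2 - 1" "well x0 r (x - z) = (norm (x - x0 - z))\<^sup>2 / r\<^sup>2 - 1"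
      using well_inside[OF r, of "x + z" x0] well_inside[OF r, of "x - z" x0] unfolding e by auto
    moreover have "well x0 r x = (norm (x - x0))\<^sup>2 / r\<^sup>2 - 1" using x by (intro well_inside r) auto
    ultimately have "S z = (2 * (norm (x - x0))\<^sup>2 - ((norm (x - x0 + z))\<^sup>2 + (norm (x - x0 - z))\<^sup>2)) / r\<^sup>2"
      by (simp add: S_def diff_divide_distrib add_divide_distrib)
    also have "\<dots> = - 2 * (norm z)\<^sup>2 / r\<^sup>2" unfolding norm_parallelogram by simp
    finally have "\<bar>S z\<bar> = 2 * ((norm z)\<^sup>2 / r\<^sup>2)" by (simp add: abs_divide)
    also have "\<dots> \<le> 2 * ((norm z)\<^sup>2 / \<delta>\<^sup>2)"
      using d0 dr r by (intro mult_left_mono divide_left_mono power_mono) auto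
    finally show ?thesis using True d0 by (simp add: min_def power_mono)
  next
    case False
    then have "\<delta>\<^sup>2 \<le> (norm z)\<^sup>2" using d0 by (intro power_mono) auto
    then have "min ((norm z)\<^sup>2 / \<delta>\<^sup>2) 1 = 1" using d0 by simp
    moreover have "\<bar>S z\<bar> \<le> 2"
      using well_range[of x0 r x] well_range[of x0 r "x + z"] well_range[of x0 r "x - z"]
      unfolding S_def by linarith
    ultimately show ?thesis by simp
  qed
  have "integrable lborel (\<lambda>z. S z / norm z powr p)"
  proof (rule Bochner_Integration.integrable_bound)
    show "integrable lborel (\<lambda>z::real^'n. 2 * (min ((norm z)\<^sup>2 / \<delta>\<^sup>2) 1 / norm z powr p))"
      using integral_fractional_kernel_scaled(1)[OF s d0, where 'a = "real^'n"]
      unfolding p_def by (intro integrable_mult_right) simp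
    show "(\<lambda>z. S z / norm z powr p) \<in> borel_measurable lborel" unfolding S_def by measurable
    show "AE z in lborel. norm (S z / norm z powr p) \<le> norm (2 * (min ((norm z)\<^sup>2 / \<delta>\<^sup>2) 1 / norm z powr p))"
    proof (rule AE_I2)
      fix z :: "real^'n"
      have "\<bar>S z\<bar> / norm z powr p \<le> 2 * min ((norm z)\<^sup>2 / \<delta>\<^sup>2) 1 / norm z powr p"
        using le[of z] by (rule divide_right_mono) simp
      also have "\<dots> \<le> \<bar>2 * (min ((norm z)\<^sup>2 / \<delta>\<^sup>2) 1 / norm z powr p)\<bar>" by simp
      finally show "norm (S z / norm z powr p) \<le> norm (2 * (min ((norm z)\<^sup>2 / \<delta>\<^sup>2) 1 / norm z powr p))"
        by simp
    qed
  qed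
  then show ?thesis by (simp add: S_def p_def)
qed

lemma frac_laplacian_const_pos:
  assumes "0 < s" "s < 1"
  shows "0 < frac_laplacian_const (real CARD('n::finite)) s"
proof -
  have "0 < (real CARD('n) + 2 * s) / 2" using assms by (simp add: add_nonneg_pos)
  then have "0 < Gamma ((real CARD('n) + 2 * s) / 2)" by (rule Gamma_real_pos)
  moreover have "0 < Gamma (1 - s)" using assms by (intro Gamma_real_pos) simp
  ultimately show ?thesis using assms by (simp add: frac_laplacian_const_def)
qed

text \<open>At a minimum \<open>x\<close>, within the half-space, of the reflected difference \<open>W\<close> plus a small well \<open>\<kappa> q\<close>
around a nearby point \<open>x0\<close>, both spatial operators applied to \<open>W\<close> have a sign up to an error of
order \<open>\<kappa>\<close>, and the fractional one gains a multiple of \<open>m\<close>. Subtracting the mirror image of the well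
restores antisymmetry without changing anything in the half-space, because the well is supported
there; so the antisymmetric maximum principle applies to \<open>v = W + \<kappa> (q - q o R)\<close>, and the well and
its image cost at most \<open>4 \<kappa>\<close> times the kernel truncated at scale \<open>r\<close>. The case \<open>\<kappa> = 0\<close>, \<open>m = 0\<close> is
the plain statement at a minimum.\<close>

lemma spatial_operators_at_perturbed_minimum:
  fixes U :: "real ^ 'n::finite \<Rightarrow> real" and x x0 :: "real ^ 'n"
  assumes s: "0 < s" "s < 1" and U: "U \<in> C2_space" and cont: "continuous_on UNIV U"
    and bd: "\<And>y. \<bar>U y\<bar> \<le> M"
    and r: "0 < r" and x0: "x0 $ k = \<mu> - 2 * r" and x: "norm (x - x0) < r" and kap: "0 \<le> \<kappa>"
  defines "P \<equiv> \<lambda>y. U (reflect k \<mu> y) - U y + \<kappa> * well x0 r y"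
  assumes min: "\<And>y. y $ k < \<mu> \<Longrightarrow> P x \<le> P y" and neg: "P x \<le> - m" and m: "0 \<le> m"
  shows "frac_laplacian s U (reflect k \<mu> x) - frac_laplacian s U x \<le> frac_laplacian_const (real CARD('n)) s *
      (2 * \<kappa> * r powr (- 2 * s) * (LINT z|lborel. min ((norm (z::real^'n))\<^sup>2) 1 / norm z powr (real CARD('n) + 2 * s))
       - m * (unit_ball_vol (real CARD('n)) * 3 powr - (real CARD('n) + 2 * s)) * (\<mu> - x $ k) powr (- 2 * s))"
    and "laplacian U x - laplacian U (reflect k \<mu> x) \<le> 2 * real CARD('n) * \<kappa> / r\<^sup>2"
proof -
  define p where "p = real CARD('n) + 2 * s"
  define A where "A = unit_ball_vol (real CARD('n)) * 3 powr - p"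
  define R where "R = (reflect k \<mu> :: real^'n \<Rightarrow> _)"
  define J where "J = (LINT z|lborel. min ((norm (z::real^'n))\<^sup>2) 1 / norm z powr p)"
  define W where "W y = U (R y) - U y" for y
  define q where "q = well x0 r"
  define v where "v y = W y + \<kappa> * (q y - q (R y))" for y
  define S where "S f z = (2 * f x - f (x + z) - f (x - z)) / norm z powr p" for f :: "real^'n \<Rightarrow> real" and z
  define \<Phi> where "\<Phi> z = min ((norm z)\<^sup>2 / r\<^sup>2) 1 / norm z powr p" for z :: "real^'n"
  have [measurable]: "U \<in> borel_measurable borel" using cont by (rule borel_measurable_continuous_onI)
  have [measurable]: "R \<in> borel_measurable borel" "q \<in> borel_measurable borel" by (simp_all add: R_def q_def)
  have [measurable]: "W \<in> borel_measurable borel" "v \<in> borel_measurable borel"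
    unfolding W_def v_def by measurable
  have RR: "R (R y) = y" for y by (simp add: R_def)
  have Rk: "R y $ k = 2 * \<mu> - y $ k" for y by (simp add: R_def reflect_nth)
  have Radd: "R (y + z) = R y + reflect k 0 z" "R (y - z) = R y - reflect k 0 z" for y z
    by (simp_all add: R_def reflect_add reflect_diff)
  have Pv: "P y = W y + \<kappa> * q y" for y by (simp add: P_def W_def R_def q_def)
  have comp: "(y - x0) $ k \<le> norm (y - x0)" for y
    using component_le_norm_cart[of "y - x0" k] by (simp add: abs_le_iff)
  have xk: "x $ k < \<mu> - r" using comp[of x] x x0 by simp
  have qR0: "q (R y) = 0" if "y $ k \<le> \<mu>" for y
  proof -
    have "r \<le> norm (R y - x0)" using comp[of "R y"] Rk[of y] that x0 r by simp
    then show ?thesis unfolding q_def by (intro well_outside r)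
  qed
  have vP: "v y = P y" if "y $ k \<le> \<mu>" for y using qR0[OF that] by (simp add: v_def Pv)
  have vx: "v x = P x" using vP xk r by simp
  have anti: "v (reflect k \<mu> y) = - v y" for y
    using RR[of y] by (simp add: v_def W_def algebra_simps flip: R_def)
  have bv: "\<bar>v y\<bar> \<le> 2 * M + \<kappa>" for y
  proof -
    have "\<bar>W y\<bar> \<le> 2 * M" using bd[of "R y"] bd[of y] by (simp add: W_def abs_le_iff)
    moreover have "\<bar>q y - q (R y)\<bar> \<le> 1"
      using well_range[of x0 r y] well_range[of x0 r "R y"] unfolding q_def by linarith
    then have "\<bar>\<kappa> * (q y - q (R y))\<bar> \<le> \<kappa> * 1" unfolding abs_mult using kap by (intro mult_mono) auto
    ultimately show ?thesis unfolding v_def by linarith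
  qed
  have vmin: "v x \<le> v y" if "y $ k < \<mu>" for y
    using min[OF that] that by (simp add: vx vP)
  define DU where "DU y z = (2 * U y - U (y + z) - U (y - z)) / norm z powr p" for y z
  note FL = frac_laplacian_eq_second_difference[OF s U cont bd]
  have iDU: "integrable lborel (DU y)" for y using FL(1)[of y] by (simp add: DU_def[abs_def] p_def)
  have rm: "integrable lborel (\<lambda>z. DU (R x) (reflect k 0 z))"
       "(LINT z|lborel. DU (R x) (reflect k 0 z)) = integral\<^sup>L lborel (DU (R x))"
    using lborel_measure_preserving[OF distr_lborel_reflect reflect_measurable, of "DU (R x)" k 0] iDU[of "R x"]
    by auto
  have SW: "S W z = DU (R x) (reflect k 0 z) - DU x z" for z
    by (simp add: S_def W_def DU_def Radd diff_divide_distrib add_divide_distrib)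
  have iSW: "integrable lborel (S W)" using rm(1) iDU[of x] by (simp add: SW[abs_def])
  have ISW: "integral\<^sup>L lborel (S W) = integral\<^sup>L lborel (DU (R x)) - integral\<^sup>L lborel (DU x)"
    using rm iDU[of x] by (simp add: SW[abs_def])
  have i\<Phi>: "integrable lborel \<Phi>" and I\<Phi>: "integral\<^sup>L lborel \<Phi> = r powr (- 2 * s) * J"
    using integral_fractional_kernel_scaled[OF s r, where 'a = "real^'n"]
    by (simp_all add: \<Phi>_def[abs_def] p_def J_def)
  have iSq: "integrable lborel (S q)"
    using well_second_difference_integrable[OF s r x] by (simp add: S_def[abs_def] q_def p_def)
  have qRx: "q (R x) = 0" using qR0 xk r by simp
  \<comment> \<open>the mirrored well vanishes on the ball of radius \<open>r\<close> around \<open>x\<close>, since \<open>x $ k < \<mu> - r\<close>\<close>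
  have SqR: "0 \<le> S (\<lambda>y. q (R y)) z" "S (\<lambda>y. q (R y)) z \<le> 2 * \<Phi> z" for z
  proof -
    have "0 \<le> 2 * q (R x) - q (R (x + z)) - q (R (x - z))"
      using well_range(2)[of x0 r] qRx unfolding q_def by (smt (verit))
    then show "0 \<le> S (\<lambda>y. q (R y)) z" unfolding S_def by simp
    have "2 * q (R x) - q (R (x + z)) - q (R (x - z)) \<le> 2 * min ((norm z)\<^sup>2 / r\<^sup>2) 1"
    proof (cases "norm z < r")
      case True
      then have "(x + z) $ k \<le> \<mu>" "(x - z) $ k \<le> \<mu>"
        using xk component_le_norm_cart[of z k] by (auto simp: abs_le_iff)
      then show ?thesis using qR0 qRx by simp
    next
      case False
      then have "r\<^sup>2 \<le> (norm z)\<^sup>2" using r by (intro power_mono) auto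
      then have "min ((norm z)\<^sup>2 / r\<^sup>2) 1 = 1" using r by simp
      moreover have "- q (R (x + z)) - q (R (x - z)) \<le> 2"
        using well_range(1)[of x0 r "R (x + z)"] well_range(1)[of x0 r "R (x - z)"] unfolding q_def by linarith
      ultimately show ?thesis using qRx by simp
    qed
    from divide_right_mono[OF this, of "norm z powr p"]
    show "S (\<lambda>y. q (R y)) z \<le> 2 * \<Phi> z" by (simp add: S_def \<Phi>_def)
  qed
  have iSqR: "integrable lborel (S (\<lambda>y. q (R y)))"
  proof (rule Bochner_Integration.integrable_bound)
    show "integrable lborel (\<lambda>z. 2 * \<Phi> z)" using i\<Phi> by simp
    show "S (\<lambda>y. q (R y)) \<in> borel_measurable lborel" unfolding S_def by measurable
    show "AE z in lborel. norm (S (\<lambda>y. q (R y)) z) \<le> norm (2 * \<Phi> z)"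
      using SqR by (intro AE_I2) (smt (verit) real_norm_def)
  qed
  have Sv: "S v z = S W z + \<kappa> * S q z - \<kappa> * S (\<lambda>y. q (R y)) z" for z
    by (simp add: S_def v_def diff_divide_distrib add_divide_distrib algebra_simps)
  have iSv: "integrable lborel (S v)" using iSW iSq iSqR by (simp add: Sv[abs_def])
  have ISv: "integral\<^sup>L lborel (S v) \<le> 2 * v x * A * (\<mu> - x $ k) powr (- 2 * s)"
    unfolding S_def[abs_def] A_def p_def
  proof (rule antisymmetric_minimum_integral_le[where M = "2 * M + \<kappa>" and \<mu> = \<mu> and k = k])
    show "integrable lborel (\<lambda>z. (2 * v x - v (x + z) - v (x - z)) / norm z powr (real CARD('n) + 2 * s))"
      using iSv by (simp add: S_def[abs_def] p_def)
    show "x $ k < \<mu>" using xk r by simp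
    show "v x \<le> 0" using neg m vx by simp
  qed (use vmin s bv anti in auto)
  have Sq_le: "- S q z \<le> 2 * \<Phi> z" for z
  proof -
    have "q (x + z) + q (x - z) - 2 * q x \<le> 2 * min ((norm z)\<^sup>2 / r\<^sup>2) 1"
      unfolding q_def by (rule well_second_difference_le[OF r x])
    from divide_right_mono[OF this, of "norm z powr p"]
    show ?thesis by (simp add: S_def \<Phi>_def diff_divide_distrib add_divide_distrib)
  qed
  have "S W z \<le> S v z + 4 * \<kappa> * \<Phi> z" for z
  proof -
    have "\<kappa> * (- S q z + S (\<lambda>y. q (R y)) z) \<le> \<kappa> * (4 * \<Phi> z)"
      using Sq_le[of z] SqR(2)[of z] kap by (intro mult_left_mono) auto
    then show ?thesis by (simp add: Sv algebra_simps)
  qed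
  then have "integral\<^sup>L lborel (S W) \<le> (LINT z|lborel. S v z + 4 * \<kappa> * \<Phi> z)"
    using iSW iSv i\<Phi> by (intro integral_mono) auto
  also have "\<dots> = integral\<^sup>L lborel (S v) + 4 * \<kappa> * (r powr (- 2 * s) * J)"
    using iSv i\<Phi> by (simp add: I\<Phi>)
  also have "\<dots> \<le> - 2 * m * A * (\<mu> - x $ k) powr (- 2 * s) + 4 * \<kappa> * (r powr (- 2 * s) * J)"
  proof -
    have "v x * (A * (\<mu> - x $ k) powr (- 2 * s)) \<le> - m * (A * (\<mu> - x $ k) powr (- 2 * s))"
      using neg vx by (intro mult_right_mono mult_nonneg_nonneg) (auto simp: A_def)
    with ISv show ?thesis by (simp add: mult.assoc)
  qed
  finally have SWle: "integral\<^sup>L lborel (S W) / 2 \<le> 2 * \<kappa> * r powr (- 2 * s) * J - m * A * (\<mu> - x $ k) powr (- 2 * s)"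
    by simp
  have "frac_laplacian s U (R x) - frac_laplacian s U x = frac_laplacian_const (real CARD('n)) s * (integral\<^sup>L lborel (S W) / 2)"
    using FL(2)[of "R x"] FL(2)[of x] by (simp add: ISW DU_def[abs_def] p_def algebra_simps diff_divide_distrib)
  also have "\<dots> \<le> frac_laplacian_const (real CARD('n)) s * (2 * \<kappa> * r powr (- 2 * s) * J - m * A * (\<mu> - x $ k) powr (- 2 * s))"
    using frac_laplacian_const_pos[OF s, where 'n = 'n] SWle by (intro mult_left_mono) auto
  finally show "frac_laplacian s U (reflect k \<mu> x) - frac_laplacian s U x \<le> frac_laplacian_const (real CARD('n)) s *
      (2 * \<kappa> * r powr (- 2 * s) * (LINT z|lborel. min ((norm (z::real^'n))\<^sup>2) 1 / norm z powr (real CARD('n) + 2 * s))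
       - m * (unit_ball_vol (real CARD('n)) * 3 powr - (real CARD('n) + 2 * s)) * (\<mu> - x $ k) powr (- 2 * s))"
    by (simp add: R_def J_def A_def p_def)
  have "partial_deriv i (partial_deriv i U) x - partial_deriv i (partial_deriv i U) (R x) \<le> 2 * \<kappa> / r\<^sup>2" for i
  proof -
    let ?e = "\<lambda>h::real. h *\<^sub>R axis i 1 :: real^'n"
    define Q where "Q y h = (U (y + ?e h) + U (y - ?e h) - 2 * U y) / h\<^sup>2" for y h
    have "((\<lambda>h. Q x h - Q (R x) h) \<longlongrightarrow>
        partial_deriv i (partial_deriv i U) x - partial_deriv i (partial_deriv i U) (R x)) (at_right 0)"
      unfolding Q_def by (intro tendsto_diff C2_space_axis_difference_quotient[OF U])
    moreover have "\<forall>\<^sub>F h in at_right 0. Q x h - Q (R x) h \<le> 2 * \<kappa> / r\<^sup>2"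
    proof -
      have "Q x h - Q (R x) h \<le> 2 * \<kappa> / r\<^sup>2" if h: "0 < h" "h < r" for h
      proof -
        have n: "norm (?e h) = h" using h by simp
        have in1: "(x + ?e h) $ k < \<mu>" "(x - ?e h) $ k < \<mu>"
          using xk h component_le_norm_cart[of "?e h" k]
          unfolding n vector_add_component vector_minus_component by linarith+
        (* Reflecting an axis step either fixes it or changes its sign, and second differences
           do not distinguish the two. *)
        have sym: "U (R x + ?e h) + U (R x - ?e h) = U (R (x + ?e h)) + U (R (x - ?e h))"
        proof (cases "i = k")
          case True
          then have "reflect k 0 (?e h) = - ?e h" by (auto simp: vec_eq_iff reflect_nth axis_def)
          then show ?thesis by (simp add: Radd)
        next
          case False
          then have "reflect k 0 (?e h) = ?e h" by (auto simp: vec_eq_iff reflect_nth axis_def)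
          then show ?thesis by (simp add: Radd)
        qed
        have "2 * P x \<le> P (x + ?e h) + P (x - ?e h)" using min[OF in1(1)] min[OF in1(2)] by simp
        moreover have "\<kappa> * (q (x + ?e h) + q (x - ?e h) - 2 * q x) \<le> \<kappa> * (2 * (h\<^sup>2 / r\<^sup>2))"
          using well_second_difference_le[OF r x, of "?e h"] kap n unfolding q_def
          by (intro mult_left_mono) auto
        ultimately have "(U (x + ?e h) + U (x - ?e h) - 2 * U x) - (U (R x + ?e h) + U (R x - ?e h) - 2 * U (R x))
            \<le> \<kappa> * (2 * (h\<^sup>2 / r\<^sup>2))"
          unfolding sym by (simp add: Pv W_def algebra_simps)
        from divide_right_mono[OF this, of "h\<^sup>2"] show ?thesis
          using h by (simp add: Q_def diff_divide_distrib mult.commute)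
      qed
      then show ?thesis using r by (auto simp: eventually_at_right[of 0 "0 + r"] eventually_at_right_field)
    qed
    ultimately show ?thesis by (rule tendsto_upperbound) simp
  qed
  then have "laplacian U x - laplacian U (R x) \<le> (\<Sum>i\<in>(UNIV::'n set). 2 * \<kappa> / r\<^sup>2)"
    unfolding laplacian_def sum_subtractf[symmetric] by (intro sum_mono)
  then show "laplacian U x - laplacian U (reflect k \<mu> x) \<le> 2 * real CARD('n) * \<kappa> / r\<^sup>2"
    by (simp add: R_def mult_ac)
qed

section \<open>The evolution operator at near-minima of the reflected difference\<close>

definition evolution_op :: "real \<Rightarrow> real \<Rightarrow> (real ^ 'n::finite \<Rightarrow> real \<Rightarrow> real) \<Rightarrow> real ^ 'n \<Rightarrow> real \<Rightarrow> real" where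
  "evolution_op s \<alpha> u x t =
     time_deriv \<alpha> (u x) t + frac_laplacian s (\<lambda>y. u y t) x - laplacian (\<lambda>y. u y t) x"

text \<open>Half of the constant in the gain of the fractional Laplacian at a negative minimum; the other half
absorbs the perturbation errors.\<close>

definition gap_const :: "'n::finite itself \<Rightarrow> real \<Rightarrow> real" where
  "gap_const _ s = frac_laplacian_const (real CARD('n)) s *
     (unit_ball_vol (real CARD('n)) * 3 powr - (real CARD('n) + 2 * s)) / 2"

lemma gap_const_pos: "0 < s \<Longrightarrow> s < 1 \<Longrightarrow> 0 < gap_const TYPE('n::finite) s"
  unfolding gap_const_def using frac_laplacian_const_pos[of s, where 'n = 'n] by simp

text \<open>The infimum \<open>- m\<close> of the reflected difference \<open>w\<close> need not be attained, since the half-space and the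
time axis are unbounded. Starting from a point \<open>(x0, t0)\<close> where \<open>w < - m + \<kappa>\<close>, adding a space
well of radius \<open>r\<close> and a time well of width \<open>T\<close>, each of depth \<open>\<kappa>\<close>, produces a minimum in a compact
neighbourhood. Here \<open>r\<close> is half the distance of \<open>x0\<close> to the plane, so the fractional error scales like
the gain; uniform continuity keeps \<open>r\<close> above some \<open>r0\<close>, as \<open>w\<close> vanishes on the plane, and this
bounds the error of the local Laplacian by the same power of the distance. So \<open>\<kappa>\<close> can be fixed before
\<open>x0\<close> is chosen, and \<open>T\<close> is taken large afterwards.\<close>

lemma evolution_op_at_near_minimum:
  fixes u :: "real ^ 'n::finite \<Rightarrow> real \<Rightarrow> real"
  assumes s: "0 < s" "s < 1" and a: "0 < \<alpha>" "\<alpha> \<le> 1"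
    and C2: "\<And>t. (\<lambda>x. u x t) \<in> C2_space" and C1: "\<And>x. u x C1_differentiable_on UNIV"
    and uc: "uniformly_continuous_on UNIV (\<lambda>(x, t). u x t)" and bd: "\<And>x t. \<bar>u x t\<bar> \<le> M"
    and m: "0 < m" and low: "\<And>x t. x $ k < \<mu> \<Longrightarrow> - m \<le> u (reflect k \<mu> x) t - u x t"
    and near: "\<And>\<eta>. 0 < \<eta> \<Longrightarrow> \<exists>x t. x $ k < \<mu> \<and> u (reflect k \<mu> x) t - u x t < - m + \<eta>"
  obtains x t where "x $ k < \<mu>" "u (reflect k \<mu> x) t < u x t"
    "evolution_op s \<alpha> u (reflect k \<mu> x) t - evolution_op s \<alpha> u x t
      \<le> - (gap_const TYPE('n) s * m * (\<mu> - x $ k) powr (- 2 * s))"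
proof -
  define n where "n = real CARD('n)"
  define c where "c = frac_laplacian_const n s"
  define A where "A = unit_ball_vol n * 3 powr - (n + 2 * s)"
  define J where "J = (LINT z|lborel. min ((norm (z::real^'n))\<^sup>2) 1 / norm z powr (n + 2 * s))"
  define w where "w x t = u (reflect k \<mu> x) t - u x t" for x t
  have c0: "0 < c" using frac_laplacian_const_pos[OF s, where 'n = 'n] by (simp add: c_def n_def)
  have A0: "0 < A" by (simp add: A_def n_def)
  have J0: "0 \<le> J" unfolding J_def by (intro Bochner_Integration.integral_nonneg) auto
  have gap: "gap_const TYPE('n) s = c * A / 2" by (simp add: gap_const_def c_def A_def n_def)
  obtain \<delta> where \<delta>: "0 < \<delta>" "\<And>x y t. norm (x - y) < \<delta> \<Longrightarrow> \<bar>u x t - u y t\<bar> < m / 2"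
  proof -
    obtain \<delta> where "0 < \<delta>" and d: "\<And>p q. dist p q < \<delta> \<Longrightarrow> dist (case p of (x, t) \<Rightarrow> u x t) (case q of (x, t) \<Rightarrow> u x t) < m / 2"
      using uc m unfolding uniformly_continuous_on_def by (metis UNIV_I half_gt_zero)
    then show ?thesis
      using that[of \<delta>] d[of "(_, _)" "(_, _)"] by (auto simp: dist_Pair_Pair dist_norm)
  qed
  define r0 where "r0 = \<delta> / 4"
  \<comment> \<open>the total perturbation error will be at most \<open>\<kappa> * Q\<close> times \<open>(\<mu> - x $ k) powr (- 2 * s)\<close>\<close>
  define Q where "Q = 18 * c * J + 18 * n * r0 powr (2 * s - 2) + 1"
  have Q0: "0 < Q" using c0 J0 by (simp add: Q_def n_def add_nonneg_pos)
  define \<kappa> where "\<kappa> = min (m / 2) (c * A * m / (2 * Q))"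
  have k0: "0 < \<kappa>" using m c0 A0 Q0 by (simp add: \<kappa>_def)
  have kQ: "\<kappa> * Q \<le> c * A * m / 2"
  proof -
    have "\<kappa> * Q \<le> c * A * m / (2 * Q) * Q" using Q0 by (intro mult_right_mono) (auto simp: \<kappa>_def)
    then show ?thesis using Q0 by simp
  qed
  obtain x0 t0 where x0: "x0 $ k < \<mu>" and wx0: "w x0 t0 < - m + \<kappa>"
    using near[OF k0] by (auto simp: w_def)
  define r where "r = (\<mu> - x0 $ k) / 2"
  have r: "0 < r" using x0 by (simp add: r_def)
  have x0k: "x0 $ k = \<mu> - 2 * r" by (simp add: r_def field_simps)
  have r0: "0 < r0" using \<delta> by (simp add: r0_def)
  have rr0: "r0 \<le> r"
  proof (rule ccontr)
    assume "\<not> r0 \<le> r"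
    then have "norm (reflect k \<mu> x0 - x0) < \<delta>" using r by (simp add: reflect_def r0_def r_def)
    from \<delta>(2)[OF this, of t0] have "- (m / 2) < w x0 t0" unfolding w_def by linarith
    moreover have "\<kappa> \<le> m / 2" by (simp add: \<kappa>_def)
    ultimately show False using wx0 by linarith
  qed
  have r3: "0 < (3 * r) powr (- 2 * s)" using r by simp
  obtain T where T: "0 < T"
    "time_cutoff_rate \<alpha> T \<le> (3 * r) powr (- 2 * s)"
    using time_error_small[OF a r3] by blast
  define \<psi> where "\<psi> t = min (\<bar>t - t0\<bar> / T) 1 - 1" for t
  define P where "P z = w (fst z) (snd z) + \<kappa> * (well x0 r (fst z) + \<psi> (snd z))" for z
  define S where "S = cball x0 r \<times> cball t0 T"
  have cu: "continuous_on UNIV (\<lambda>(x, t). u x t)" using uc by (rule uniformly_continuous_imp_continuous)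
  have cont: "continuous_on S P"
  proof -
    have cu': "continuous_on UNIV (\<lambda>z. u (fst z) (snd z))" using cu by (simp add: case_prod_unfold)
    have "continuous_on S (\<lambda>z. (reflect k \<mu> (fst z), snd z))" by (intro continuous_intros)
    from continuous_on_compose2[OF cu' this] have "continuous_on S (\<lambda>z. u (reflect k \<mu> (fst z)) (snd z))" by simp
    moreover have "continuous_on S (\<lambda>z. u (fst z) (snd z))" using cu' by (rule continuous_on_subset) simp
    moreover note r T(1)
    ultimately show ?thesis unfolding P_def w_def \<psi>_def by (auto intro!: continuous_intros)
  qed
  have "compact S" "S \<noteq> {}" using r T by (auto simp: S_def intro: compact_Times)
  from continuous_attains_inf[OF this cont] obtain z where zS: "z \<in> S" and zmin: "\<And>y. y \<in> S \<Longrightarrow> P z \<le> P y"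
    by blast
  define x where "x = fst z"
  define t where "t = snd z"
  have z: "z = (x, t)" by (simp add: x_def t_def)
  have \<psi>r: "- 1 \<le> \<psi> t" "\<psi> t \<le> 0" for t using T by (auto simp: \<psi>_def)
  have Pz: "P z < - m - \<kappa>"
  proof -
    have "P z \<le> P (x0, t0)" using r T by (intro zmin) (auto simp: S_def)
    also have "\<dots> = w x0 t0 - 2 * \<kappa>" using r T by (simp add: P_def \<psi>_def well_def)
    also have "\<dots> < - m - \<kappa>" using wx0 by simp
    finally show ?thesis .
  qed
  have far: "- m - \<kappa> \<le> P (y, \<tau>)" if "y $ k < \<mu>" "well x0 r y = 0 \<or> \<psi> \<tau> = 0" for y \<tau>
  proof -
    have "- 1 \<le> well x0 r y + \<psi> \<tau>" using that(2) \<psi>r[of \<tau>] well_range[of x0 r y] by auto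
    then have "\<kappa> * - 1 \<le> \<kappa> * (well x0 r y + \<psi> \<tau>)" using k0 by (intro mult_left_mono) auto
    then show ?thesis using low[OF that(1), of \<tau>] by (simp add: P_def w_def)
  qed
  have Pmin: "P z \<le> P (y, \<tau>)" if "y $ k < \<mu>" for y \<tau>
  proof (cases "(y, \<tau>) \<in> S")
    case True then show ?thesis by (rule zmin)
  next
    case False
    then have "r \<le> norm (y - x0) \<or> 1 \<le> \<bar>\<tau> - t0\<bar> / T"
      using T by (auto simp: S_def dist_norm norm_minus_commute)
    then have "well x0 r y = 0 \<or> \<psi> \<tau> = 0" using well_outside[OF r] by (auto simp: \<psi>_def)
    from far[OF that this] Pz show ?thesis by simp
  qed
  have xr: "norm (x - x0) \<le> r" using zS by (simp add: S_def z dist_norm norm_minus_commute)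
  have xk: "\<bar>x $ k - x0 $ k\<bar> \<le> r" using component_le_norm_cart[of "x - x0" k] xr by simp
  then have x\<mu>: "x $ k < \<mu>" using x0k r by (simp add: abs_le_iff)
  have xr': "norm (x - x0) < r"
    using far[OF x\<mu>, of t] Pz well_outside[OF r, of x x0] xr unfolding z by force
  have wneg: "w x t + \<kappa> * well x0 r x \<le> - m"
  proof -
    have "\<kappa> * - 1 \<le> \<kappa> * \<psi> t" using k0 \<psi>r by (intro mult_left_mono) auto
    then show ?thesis using Pz by (simp add: P_def z algebra_simps)
  qed
  have wlt: "w x t < 0"
  proof -
    have "\<kappa> * - 1 \<le> \<kappa> * well x0 r x" using k0 well_range by (intro mult_left_mono) auto
    moreover have "\<kappa> \<le> m / 2" by (simp add: \<kappa>_def)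
    ultimately show ?thesis using wneg m by linarith
  qed
  define D where "D = (\<mu> - x $ k) powr (- 2 * s)"
  have d: "0 < \<mu> - x $ k" "\<mu> - x $ k \<le> 3 * r" using xk x0k r by (auto simp: abs_le_iff)
  have D0: "0 < D" using d by (simp add: D_def)
  have D3: "(3 * r) powr (- 2 * s) \<le> D"
    unfolding D_def using d s by (intro powr_mono2') auto
  (* The distance of x to the plane is at most 3 * r, and 3 powr (2 * s) is at most 9. *)
  have rD: "r powr (- 2 * s) \<le> 9 * D"
  proof -
    have "(3::real) powr (- 2) \<le> 3 powr (- 2 * s)" using s by (intro powr_mono) auto
    then have "1 / 9 \<le> (3::real) powr (- 2 * s)" by (simp add: powr_minus_divide)
    then have "1 / 9 * r powr (- 2 * s) \<le> 3 powr (- 2 * s) * r powr (- 2 * s)" by (intro mult_right_mono) auto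
    also have "\<dots> = (3 * r) powr (- 2 * s)" using r by (simp add: powr_mult)
    finally show ?thesis using D3 by simp
  qed
  have r2: "1 / r\<^sup>2 \<le> 9 * D * r0 powr (2 * s - 2)"
  proof -
    have "1 / r\<^sup>2 = r powr (- 2 * s) * r powr (2 * s - 2)"
      unfolding powr_add[symmetric] using r by (simp add: powr_minus_divide)
    also have "\<dots> \<le> (9 * D) * r0 powr (2 * s - 2)"
      using rD rr0 r0 s D0 by (intro mult_mono powr_mono2') auto
    finally show ?thesis .
  qed
  have bU: "continuous_on UNIV (\<lambda>y. u y t)"
  proof -
    have "continuous_on UNIV (\<lambda>y. (\<lambda>(x, t). u x t) (y, t))"
      by (intro continuous_on_compose2[OF cu] continuous_intros; simp)
    then show ?thesis by simp
  qed
  have minU: "u (reflect k \<mu> x) t - u x t + \<kappa> * well x0 r x \<le> u (reflect k \<mu> y) t - u y t + \<kappa> * well x0 r y"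
    if "y $ k < \<mu>" for y
    using Pmin[OF that, of t] by (simp add: P_def z w_def algebra_simps)
  have spatial: "frac_laplacian s (\<lambda>y. u y t) (reflect k \<mu> x) - frac_laplacian s (\<lambda>y. u y t) x
      \<le> c * (2 * \<kappa> * r powr (- 2 * s) * J - m * A * D)"
    "laplacian (\<lambda>y. u y t) x - laplacian (\<lambda>y. u y t) (reflect k \<mu> x) \<le> 2 * n * \<kappa> / r\<^sup>2"
    using spatial_operators_at_perturbed_minimum[OF s C2[of t] bU bd r x0k xr' _ minU, of m] wneg k0 m
    by (simp_all add: c_def J_def A_def D_def n_def w_def)
  have FL: "frac_laplacian s (\<lambda>y. u y t) (reflect k \<mu> x) - frac_laplacian s (\<lambda>y. u y t) x
      \<le> \<kappa> * (18 * c * J) * D - c * A * m * D"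
  proof -
    have "(2 * c * \<kappa> * J) * r powr (- 2 * s) \<le> (2 * c * \<kappa> * J) * (9 * D)"
      using rD c0 k0 J0 by (intro mult_left_mono) auto
    then show ?thesis using spatial(1) by (simp add: algebra_simps)
  qed
  have LP: "laplacian (\<lambda>y. u y t) x - laplacian (\<lambda>y. u y t) (reflect k \<mu> x)
      \<le> \<kappa> * (18 * n * r0 powr (2 * s - 2)) * D"
  proof -
    have "(2 * n * \<kappa>) * (1 / r\<^sup>2) \<le> (2 * n * \<kappa>) * (9 * D * r0 powr (2 * s - 2))"
      using r2 k0 by (intro mult_left_mono) (auto simp: n_def)
    then show ?thesis using spatial(2) by (simp add: algebra_simps)
  qed
  have TD: "time_deriv \<alpha> (u (reflect k \<mu> x)) t - time_deriv \<alpha> (u x) t \<le> \<kappa> * D"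
  proof -
    have "time_deriv \<alpha> (u (reflect k \<mu> x)) t - time_deriv \<alpha> (u x) t \<le>
      \<kappa> * time_cutoff_rate \<alpha> T"
    proof (rule time_deriv_diff_le[OF a C1 bd C1 bd T(1)])
      fix \<sigma> :: real assume \<sigma>: "0 < \<sigma>"
      have "\<psi> (t - \<sigma>) \<le> \<psi> t + \<sigma> / T"
      proof -
        have "\<bar>t - \<sigma> - t0\<bar> / T \<le> (\<bar>t - t0\<bar> + \<sigma>) / T" using \<sigma> T by (intro divide_right_mono) auto
        then have "\<bar>t - \<sigma> - t0\<bar> / T \<le> \<bar>t - t0\<bar> / T + \<sigma> / T" by (simp only: add_divide_distrib)
        moreover have "0 \<le> \<sigma> / T" using \<sigma> T by simp
        ultimately show ?thesis unfolding \<psi>_def by linarith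
      qed
      then have "\<psi> (t - \<sigma>) - \<psi> t \<le> min (\<sigma> / T) 1" using \<psi>r[of t] \<psi>r[of "t - \<sigma>"] by simp
      then have "\<kappa> * (\<psi> (t - \<sigma>) - \<psi> t) \<le> \<kappa> * min (\<sigma> / T) 1" using k0 by (intro mult_left_mono) auto
      then show "u (reflect k \<mu> x) t - u x t - (u (reflect k \<mu> x) (t - \<sigma>) - u x (t - \<sigma>)) \<le> \<kappa> * min (\<sigma> / T) 1"
        using Pmin[OF x\<mu>, of "t - \<sigma>"] by (simp add: P_def z w_def algebra_simps)
    qed (use k0 in auto)
    also have "\<dots> \<le> \<kappa> * D" using T(2) D3 k0 by (intro mult_left_mono) auto
    finally show ?thesis .
  qed
  have "evolution_op s \<alpha> u (reflect k \<mu> x) t - evolution_op s \<alpha> u x t \<le> \<kappa> * Q * D - c * A * m * D"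
    using FL LP TD by (simp add: evolution_op_def Q_def algebra_simps)
  also have "\<dots> \<le> c * A * m / 2 * D - c * A * m * D"
    using kQ D0 by (intro diff_right_mono mult_right_mono) auto
  also have "\<dots> = - (gap_const TYPE('n) s * m * (\<mu> - x $ k) powr (- 2 * s))"
    by (simp add: gap D_def)
  finally show ?thesis using that x\<mu> wlt by (simp add: w_def)
qed

lemma evolution_op_at_zero_minimum:
  fixes u :: "real ^ 'n::finite \<Rightarrow> real \<Rightarrow> real"
  assumes s: "0 < s" "s < 1" and a: "0 < \<alpha>" "\<alpha> \<le> 1"
    and C2: "\<And>t. (\<lambda>x. u x t) \<in> C2_space" and C1: "\<And>x. u x C1_differentiable_on UNIV"
    and cont: "continuous_on UNIV (\<lambda>y. u y t)" and bd: "\<And>x t. \<bar>u x t\<bar> \<le> M"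
    and nonneg: "\<And>x t. x $ k < \<mu> \<Longrightarrow> u x t \<le> u (reflect k \<mu> x) t"
    and x: "x $ k < \<mu>" and eq: "u (reflect k \<mu> x) t = u x t"
  shows "evolution_op s \<alpha> u (reflect k \<mu> x) t \<le> evolution_op s \<alpha> u x t"
proof -
  define r where "r = (\<mu> - x $ k) / 2"
  have r: "0 < r" "x $ k = \<mu> - 2 * r" "norm (x - x) < r" using x by (auto simp: r_def field_simps)
  have "frac_laplacian s (\<lambda>y. u y t) (reflect k \<mu> x) - frac_laplacian s (\<lambda>y. u y t) x \<le> 0"
    "laplacian (\<lambda>y. u y t) x - laplacian (\<lambda>y. u y t) (reflect k \<mu> x) \<le> 0"
    using spatial_operators_at_perturbed_minimum[OF s C2[of t] cont bd r, of 0 0] nonneg eq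
    by simp_all
  moreover have "time_deriv \<alpha> (u (reflect k \<mu> x)) t - time_deriv \<alpha> (u x) t \<le> 0"
    using time_deriv_diff_le[OF a C1 bd C1 bd, of 1 0 "reflect k \<mu> x" t x] nonneg[OF x] eq by simp
  ultimately show ?thesis by (simp add: evolution_op_def)
qed

section \<open>The moving plane\<close>

lemma small_slope_near_zero:
  fixes g g' :: "real \<Rightarrow> real"
  assumes der: "\<And>v. v \<in> {0..<\<delta>} \<Longrightarrow> (g has_real_derivative g' v) (at v within {0..})"
    and cont: "continuous_on {0..<\<delta>} g'" and g'0: "g' 0 = 0" and d: "0 < \<delta>" and e: "0 < \<epsilon>"
  obtains \<eta> where "0 < \<eta>" "\<epsilon>-lipschitz_on {0..\<eta>} g"
proof -
  obtain d' where d': "0 < d'" "\<And>v. v \<in> {0..<\<delta>} \<Longrightarrow> dist v 0 < d' \<Longrightarrow> dist (g' v) (g' 0) < \<epsilon>"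
    using cont d e unfolding continuous_on_iff by (metis atLeastLessThan_iff order_refl)
  define \<eta> where "\<eta> = min \<delta> d' / 2"
  have eta: "0 < \<eta>" "\<eta> < \<delta>" "\<eta> < d'" using d d' by (auto simp: \<eta>_def)
  have "\<epsilon>-lipschitz_on {0..\<eta>} g"
  proof (rule lipschitz_onI)
    fix x y assume xy: "x \<in> {0..\<eta>}" "y \<in> {0..\<eta>}"
    have "norm (g x - g y) \<le> \<epsilon> * norm (x - y)"
    proof (rule field_differentiable_bound[of "{0..\<eta>}" g g'])
      fix z assume "z \<in> {0..\<eta>}"
      then have z: "z \<in> {0..<\<delta>}" "dist z 0 < d'" using eta by auto
      show "(g has_field_derivative g' z) (at z within {0..\<eta>})"
        using der[OF z(1)] by (rule has_field_derivative_subset) auto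
      show "norm (g' z) \<le> \<epsilon>" using d'(2)[OF z] g'0 by simp
    qed (use xy in auto)
    then show "dist (g x) (g y) \<le> \<epsilon> * dist x y" by (simp add: dist_norm)
  qed (use e in auto)
  with eta(1) show ?thesis by (rule that)
qed

lemma lipschitz_on_bounded_interval:
  fixes g :: "real \<Rightarrow> real"
  assumes pos: "\<And>v. 0 < v \<Longrightarrow> \<exists>e>0. \<exists>L. L-lipschitz_on (ball v e \<inter> {0<..}) g"
    and zero: "0 < \<eta>" "K-lipschitz_on {0..\<eta>} g"
  obtains L where "0 < L" "L-lipschitz_on {0..M} g"
proof -
  have "local_lipschitz {0::real} {0..M} (\<lambda>_. g)"
    unfolding local_lipschitz_def
  proof (intro ballI)
    fix v t :: real assume v: "v \<in> {0..M}"
    have "\<exists>e>0. \<exists>L. L-lipschitz_on (cball v e \<inter> {0..M}) g"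
    proof (cases "v = 0")
      case True
      have "K-lipschitz_on (cball v \<eta> \<inter> {0..M}) g"
        by (rule lipschitz_on_subset[OF zero(2)]) (auto simp: True dist_real_def)
      then show ?thesis using zero(1) by blast
    next
      case False
      then have v0: "0 < v" using v by simp
      obtain e L where e: "0 < e" and L: "L-lipschitz_on (ball v e \<inter> {0<..}) g" using pos[OF v0] by blast
      have "L-lipschitz_on (cball v (min e v / 2) \<inter> {0..M}) g"
        by (rule lipschitz_on_subset[OF L]) (use e v0 in \<open>auto simp: dist_real_def abs_if split: if_splits\<close>)
      then show ?thesis using e v0 by (intro exI[of _ "min e v / 2"]) auto
    qed
    then show "\<exists>u>0. \<exists>L. \<forall>t\<in>cball t u \<inter> {0}. L-lipschitz_on (cball v u \<inter> {0..M}) g" by blast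
  qed
  then obtain L where L: "\<And>t. t \<in> {0::real} \<Longrightarrow> L-lipschitz_on {0..M} g"
    by (rule local_lipschitz_compact_implies_lipschitz) auto
  show ?thesis
    by (rule that[of "\<bar>L\<bar> + 1"]) (use lipschitz_on_le[OF L, of 0 "\<bar>L\<bar> + 1"] in auto)
qed

text \<open>What it means for the comparison to fail at the plane \<open>\<mu>\<close>: let \<open>m > 0\<close> be the supremum of the violations. At
a suitable point, the value of the evolution operator at the mirror image minus its value at the point itself is
bounded above by the negative gain. By the equation, this difference is that of the right-hand
sides. Splitting \<open>f (x') * g (u x') - f x * g (u x)\<close>, with \<open>x'\<close> the image of \<open>x\<close>, into
\<open>(f x' - f x) * g (u x')\<close>, which is positive, and \<open>f x * (g (u x') - g (u x))\<close> leads to an inequality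
that forces \<open>f\<close> to be positive at the point and bounds both the gain and the jump of \<open>f\<close> in terms of
the slope of \<open>g\<close>.\<close>

lemma moving_plane_failure_point:
  fixes u :: "real ^ 'n::finite \<Rightarrow> real \<Rightarrow> real"
  assumes s: "0 < s" "s < 1" and a: "0 < \<alpha>" "\<alpha> \<le> 1"
    and C2: "\<And>t. (\<lambda>x. u x t) \<in> C2_space" and C1: "\<And>x. u x C1_differentiable_on UNIV"
    and uc: "uniformly_continuous_on UNIV (\<lambda>(x, t). u x t)" and bd: "\<And>x t. \<bar>u x t\<bar> \<le> M"
    and upos: "\<And>x t. 0 < u x t"
    and f: "strict_mono f" and gmono: "mono_on {0<..} g" and gpos: "\<And>v. 0 < v \<Longrightarrow> 0 < g v"
    and pde: "\<And>x t. evolution_op s \<alpha> u x t = f (x $ k) * g (u x t)"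
    and fail: "y $ k < \<mu>" "u (reflect k \<mu> y) \<tau> < u y \<tau>"
  obtains m x t where "0 < m" "x $ k < \<mu>" "u (reflect k \<mu> x) t < u x t" "u x t - u (reflect k \<mu> x) t \<le> m" "0 < f (x $ k)"
    "\<And>\<eta>. (\<And>x t. x $ k < \<mu> \<Longrightarrow> u x t - u (reflect k \<mu> x) t \<le> \<eta>) \<Longrightarrow> m \<le> \<eta>"
    "gap_const TYPE('n) s * m * (\<mu> - x $ k) powr (- 2 * s)
      + (f (2 * \<mu> - x $ k) - f (x $ k)) * g (u (reflect k \<mu> x) t)
      \<le> f (x $ k) * (g (u x t) - g (u (reflect k \<mu> x) t))"
proof -
  define X where "X = {u x t - u (reflect k \<mu> x) t | x t. x $ k < \<mu>}"
  define m where "m = Sup X"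
  have X: "X \<noteq> {}" using fail by (auto simp: X_def)
  have Xb: "bdd_above X"
  proof (rule bdd_aboveI)
    fix y assume "y \<in> X"
    then obtain x t where "y = u x t - u (reflect k \<mu> x) t" by (auto simp: X_def)
    then show "y \<le> 2 * M" using bd[of x t] bd[of "reflect k \<mu> x" t] by (simp add: abs_le_iff)
  qed
  have up: "u x t - u (reflect k \<mu> x) t \<le> m" if "x $ k < \<mu>" for x t
    unfolding m_def using that by (intro cSup_upper Xb) (auto simp: X_def)
  have m0: "0 < m" using up[OF fail(1), of \<tau>] fail(2) by simp
  have least: "m \<le> \<eta>" if "\<And>x t. x $ k < \<mu> \<Longrightarrow> u x t - u (reflect k \<mu> x) t \<le> \<eta>" for \<eta>
    unfolding m_def using that by (intro cSup_least X) (auto simp: X_def)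
  have near: "\<exists>x t. x $ k < \<mu> \<and> u (reflect k \<mu> x) t - u x t < - m + \<eta>" if "0 < \<eta>" for \<eta>
  proof (rule ccontr)
    assume "\<not> ?thesis"
    then have no: "\<not> u (reflect k \<mu> x) t - u x t < - m + \<eta>" if "x $ k < \<mu>" for x t
      using that by blast
    have "m \<le> m - \<eta>"
    proof (rule least)
      fix x t assume "x $ k < \<mu>"
      from no[OF this, of t] show "u x t - u (reflect k \<mu> x) t \<le> m - \<eta>" by linarith
    qed
    with that show False by simp
  qed
  obtain x t where x: "x $ k < \<mu>" "u (reflect k \<mu> x) t < u x t" and
    op: "evolution_op s \<alpha> u (reflect k \<mu> x) t - evolution_op s \<alpha> u x t
      \<le> - (gap_const TYPE('n) s * m * (\<mu> - x $ k) powr (- 2 * s))"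
    using evolution_op_at_near_minimum[OF s a C2 C1 uc bd m0 _ near] up by (smt (verit, best))
  have Rk: "reflect k \<mu> x $ k = 2 * \<mu> - x $ k" by (simp add: reflect_nth)
  have ineq: "gap_const TYPE('n) s * m * (\<mu> - x $ k) powr (- 2 * s)
      + (f (2 * \<mu> - x $ k) - f (x $ k)) * g (u (reflect k \<mu> x) t)
      \<le> f (x $ k) * (g (u x t) - g (u (reflect k \<mu> x) t))"
    using op unfolding pde Rk by (simp add: algebra_simps)
  have "0 < gap_const TYPE('n) s * m * (\<mu> - x $ k) powr (- 2 * s)"
    using gap_const_pos[OF s, where 'n = 'n] m0 x by simp
  moreover have "0 < (f (2 * \<mu> - x $ k) - f (x $ k)) * g (u (reflect k \<mu> x) t)"
    using x f gpos upos by (intro mult_pos_pos) (auto simp: strict_mono_def)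
  ultimately have "0 < f (x $ k) * (g (u x t) - g (u (reflect k \<mu> x) t))" using ineq by linarith
  moreover have "0 \<le> g (u x t) - g (u (reflect k \<mu> x) t)"
    using gmono x(2) upos by (simp add: mono_on_def)
  ultimately have "0 < f (x $ k)" by (auto simp: zero_less_mult_iff)
  from that[OF m0 x up[OF x(1)] this least ineq] show ?thesis by blast
qed

theorem theorem1p5:
  fixes s \<alpha> :: real
    and k :: "'n::finite"
    and f g :: "real \<Rightarrow> real"
    and u :: "real ^ 'n \<Rightarrow> real \<Rightarrow> real"
  assumes s: "0 < s" "s < 1"
    and \<alpha>: "0 < \<alpha>" "\<alpha> \<le> 1"
    and f_mono: "strict_mono f"
    and f_limsup: "Limsup at_bot (\<lambda>r. ereal (f r * \<bar>r\<bar> powr (2 * s))) \<le> 0"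
    and g_lipschitz: "\<forall>v>0. \<exists>e>0. \<exists>L. L-lipschitz_on (ball v e \<inter> {0<..}) g"
    and g_mono: "mono_on {0<..} g"
    and g_deriv: "\<exists>\<delta>>0. \<exists>g'. (\<forall>v\<in>{0..<\<delta>}. (g has_real_derivative g' v) (at v within {0..}))
                    \<and> continuous_on {0..<\<delta>} g' \<and> g' 0 = 0"
    and g_zero: "g 0 = 0"
    and g_pos: "\<forall>v>0. g v > 0"
    and solution: "classical_solution s \<alpha> k f g u"
    and u_pos: "\<forall>x t. u x t > 0"
    and u_bounded: "bounded (range (\<lambda>(x, t). u x t))"
    and u_uc: "uniformly_continuous_on UNIV (\<lambda>(x, t). u x t)"
  shows "\<forall>t x h. h > 0 \<longrightarrow> u x t < u (x + h *\<^sub>R axis k 1) t"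
proof -
  obtain M where bd: "\<And>x t. \<bar>u x t\<bar> \<le> M"
    using u_bounded by (auto simp: bounded_iff)
  have upos: "0 < u x t" and gpos: "0 < v \<Longrightarrow> 0 < g v" for x t v using u_pos g_pos by auto
  have C2: "(\<lambda>x. u x t) \<in> C2_space" and C1: "u x C1_differentiable_on UNIV"
    and pde: "evolution_op s \<alpha> u x t = f (x $ k) * g (u x t)" for x t
    using solution by (auto simp: classical_solution_def evolution_op_def)
  have cu: "continuous_on UNIV (\<lambda>(x, t). u x t)" using u_uc by (rule uniformly_continuous_imp_continuous)
  have ct: "continuous_on S (\<lambda>y. u (h y) t)" if "continuous_on S h" for t h and S :: "'b::topological_space set"
  proof -
    have "continuous_on S (\<lambda>y. (\<lambda>(x, t). u x t) (h y, t))"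
      by (intro continuous_on_compose2[OF cu] continuous_intros that; simp)
    then show ?thesis by simp
  qed
  obtain \<delta> g' where g': "0 < \<delta>" "\<And>v. v \<in> {0..<\<delta>} \<Longrightarrow> (g has_real_derivative g' v) (at v within {0..})"
    "continuous_on {0..<\<delta>} g'" "g' 0 = 0" using g_deriv by blast
  have slope: "\<exists>\<eta>>0. \<epsilon>-lipschitz_on {0..\<eta>} g" if "0 < \<epsilon>" for \<epsilon>
    using small_slope_near_zero[of \<delta> g g' \<epsilon>] g' that by metis
  obtain L where L: "0 < L" "L-lipschitz_on {0..M} g"
  proof -
    obtain \<eta> where "0 < \<eta>" "1-lipschitz_on {0..\<eta>} g" using slope[of 1] by auto
    then show ?thesis using lipschitz_on_bounded_interval[of g \<eta> 1 M] g_lipschitz that by blast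
  qed
  define c where "c = gap_const TYPE('n) s"
  have c0: "0 < c" using gap_const_pos[OF s, where 'n = 'n] by (simp add: c_def)
  define good where "good \<mu> \<longleftrightarrow> (\<forall>x t. x $ k < \<mu> \<longrightarrow> u x t \<le> u (reflect k \<mu> x) t)" for \<mu>
  have failure: "\<exists>m x t. 0 < m \<and> x $ k < \<mu> \<and> u (reflect k \<mu> x) t < u x t \<and> u x t - u (reflect k \<mu> x) t \<le> m \<and> 0 < f (x $ k)
      \<and> (\<forall>\<eta>. (\<forall>x t. x $ k < \<mu> \<longrightarrow> u x t - u (reflect k \<mu> x) t \<le> \<eta>) \<longrightarrow> m \<le> \<eta>)
      \<and> c * m * (\<mu> - x $ k) powr (- 2 * s)
        + (f (2 * \<mu> - x $ k) - f (x $ k)) * g (u (reflect k \<mu> x) t)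
        \<le> f (x $ k) * (g (u x t) - g (u (reflect k \<mu> x) t))" if bad: "\<not> good \<mu>" for \<mu>
  proof -
    obtain y \<tau> where "y $ k < \<mu>" "u (reflect k \<mu> y) \<tau> < u y \<tau>"
      using bad by (auto simp: good_def not_le)
    from moving_plane_failure_point[OF s \<alpha> C2 C1 u_uc bd upos f_mono g_mono gpos pde this]
    show ?thesis unfolding c_def by (smt (verit, best))
  qed
  \<comment> \<open>the inequality at a failure point without its jump term, for any slope \<open>K\<close> of \<open>g\<close> below \<open>u x t\<close>\<close>
  have slope_ineq: "c \<le> f (x $ k) * K * (\<mu> - x $ k) powr (2 * s)"
    if m: "0 < m" and x: "x $ k < \<mu>" "u (reflect k \<mu> x) t < u x t" "u x t - u (reflect k \<mu> x) t \<le> m" "0 < f (x $ k)"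
      and ineq: "c * m * (\<mu> - x $ k) powr (- 2 * s)
        + (f (2 * \<mu> - x $ k) - f (x $ k)) * g (u (reflect k \<mu> x) t)
        \<le> f (x $ k) * (g (u x t) - g (u (reflect k \<mu> x) t))"
      and K: "0 < K" "K-lipschitz_on {0..b} g" "u x t \<le> b" for m x t \<mu> K b
  proof -
    have "g (u x t) - g (u (reflect k \<mu> x) t) \<le> K * (u x t - u (reflect k \<mu> x) t)"
      using lipschitz_onD[OF K(2), of "u x t" "u (reflect k \<mu> x) t"] K(3) x(2) upos[of x t] upos[of "reflect k \<mu> x" t]
      by (simp add: dist_real_def abs_le_iff)
    also have "\<dots> \<le> K * m" using x(3) K(1) by simp
    finally have "f (x $ k) * (g (u x t) - g (u (reflect k \<mu> x) t)) \<le> f (x $ k) * (K * m)"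
      using x(4) by simp
    moreover have "0 \<le> (f (2 * \<mu> - x $ k) - f (x $ k)) * g (u (reflect k \<mu> x) t)"
      using x(1) f_mono gpos[OF upos] by (intro mult_nonneg_nonneg) (auto simp: strict_mono_def less_imp_le)
    ultimately have "m * (c * (\<mu> - x $ k) powr (- 2 * s)) \<le> m * (f (x $ k) * K)"
      using ineq by (simp add: algebra_simps)
    then have "c * (\<mu> - x $ k) powr (- 2 * s) \<le> f (x $ k) * K" using m by simp
    from mult_right_mono[OF this, of "(\<mu> - x $ k) powr (2 * s)"]
    show ?thesis using x(1) by (simp add: mult.assoc powr_add[symmetric])
  qed
  (* The decay of f keeps failure points away from the far left, uniformly for planes up to a
     given position, because the distance to the plane is comparable to the coordinate there. *)
  have left: "\<exists>\<rho><\<Lambda>. \<forall>r<\<rho>. 0 < f r \<longrightarrow> f r * L * (\<Lambda> - r) powr (2 * s) < c" for \<Lambda>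
  proof -
    have "\<forall>y>0. \<forall>\<^sub>F r in at_bot. ereal (f r * \<bar>r\<bar> powr (2 * s)) < y"
      using f_limsup unfolding Limsup_le_iff .
    then have "\<forall>\<^sub>F r in at_bot. ereal (f r * \<bar>r\<bar> powr (2 * s)) < ereal (c / (4 * L))"
      by (elim allE[of _ "ereal (c / (4 * L))"] impE) (use c0 L in auto)
    then obtain b where b: "\<And>r. r \<le> b \<Longrightarrow> f r * \<bar>r\<bar> powr (2 * s) < c / (4 * L)"
      by (auto simp: eventually_at_bot_linorder)
    show ?thesis
    proof (intro exI[of _ "min b (- \<bar>\<Lambda>\<bar> - 1)"] conjI allI impI)
      fix r assume r: "r < min b (- \<bar>\<Lambda>\<bar> - 1)" and fr: "0 < f r"
      have "(\<Lambda> - r) powr (2 * s) \<le> (2 * \<bar>r\<bar>) powr (2 * s)"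
        using r s by (intro powr_mono2) auto
      also have "\<dots> = 2 powr (2 * s) * \<bar>r\<bar> powr (2 * s)" by (simp add: powr_mult)
      also have "\<dots> \<le> 2 powr 2 * \<bar>r\<bar> powr (2 * s)" using s by (intro mult_right_mono powr_mono) auto
      finally have "f r * L * (\<Lambda> - r) powr (2 * s) \<le> f r * L * (4 * \<bar>r\<bar> powr (2 * s))"
        using fr L by (intro mult_left_mono) auto
      also have "\<dots> = (4 * L) * (f r * \<bar>r\<bar> powr (2 * s))" by simp
      also have "\<dots> < (4 * L) * (c / (4 * L))" using b[of r] r L by (intro mult_strict_left_mono) auto
      finally show "f r * L * (\<Lambda> - r) powr (2 * s) < c" using L by simp
    qed auto
  qed
  have uM: "u x t \<le> M" for x t using bd[of x t] by (simp add: abs_le_iff)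
  have confined: "\<rho> \<le> x $ k"
    if rho: "\<forall>r<\<rho>. 0 < f r \<longrightarrow> f r * L * (\<Lambda> - r) powr (2 * s) < c" and x: "x $ k < \<mu>" "\<mu> \<le> \<Lambda>" "0 < f (x $ k)"
      and c: "c \<le> f (x $ k) * L * (\<mu> - x $ k) powr (2 * s)" for \<rho> \<Lambda> \<mu> and x :: "real^'n"
  proof (rule ccontr)
    assume "\<not> \<rho> \<le> x $ k"
    then have "f (x $ k) * L * (\<Lambda> - x $ k) powr (2 * s) < c" using rho x by simp
    moreover have "f (x $ k) * L * (\<mu> - x $ k) powr (2 * s) \<le> f (x $ k) * L * (\<Lambda> - x $ k) powr (2 * s)"
      using x s L by (intro mult_left_mono powr_mono2) auto
    ultimately show False using c by simp
  qed
  have all_good: "good \<mu>" for \<mu>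
  proof (rule ccontr)
    assume bad: "\<not> good \<mu>"
    (* The plane starts at the far left and is stopped at the infimum of the bad positions. *)
    define B where "B = {\<mu>. \<not> good \<mu>}"
    define \<mu>0 where "\<mu>0 = Inf B"
    have B: "B \<noteq> {}" using bad by (auto simp: B_def)
    obtain \<rho>0 where \<rho>0: "\<rho>0 < 0" "\<forall>r<\<rho>0. 0 < f r \<longrightarrow> f r * L * (0 - r) powr (2 * s) < c"
      using left[of 0] by blast
    have Bb: "bdd_below B"
    proof (rule bdd_belowI)
      fix \<mu> assume "\<mu> \<in> B"
      then have "\<not> good \<mu>" by (simp add: B_def)
      from failure[OF this] obtain m x t where
        "0 < m" "x $ k < \<mu>" "u (reflect k \<mu> x) t < u x t" "u x t - u (reflect k \<mu> x) t \<le> m" "0 < f (x $ k)"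
        "c * m * (\<mu> - x $ k) powr (- 2 * s)
        + (f (2 * \<mu> - x $ k) - f (x $ k)) * g (u (reflect k \<mu> x) t)
        \<le> f (x $ k) * (g (u x t) - g (u (reflect k \<mu> x) t))" by blast
      from this(2,5) slope_ineq[OF this L uM] show "\<rho>0 \<le> \<mu>"
        using confined[OF \<rho>0(2), of x \<mu>] \<rho>0(1) by force
    qed
    have good_below: "good \<mu>" if "\<mu> < \<mu>0" for \<mu>
      using cInf_lower[OF _ Bb, of \<mu>] that by (auto simp: \<mu>0_def B_def)
    have good0: "good \<mu>0"
      unfolding good_def
    proof (intro allI impI)
      fix x t assume x: "x $ k < \<mu>0"
      have "continuous_on UNIV (\<lambda>\<mu>. u (reflect k \<mu> x) t)"
        unfolding reflect_def by (intro ct continuous_intros)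
      then have "((\<lambda>\<mu>. u (reflect k \<mu> x) t) \<longlongrightarrow> u (reflect k \<mu>0 x) t) (at_left \<mu>0)"
        by (auto simp: continuous_on_def intro: filterlim_mono at_within_le_at)
      moreover have "\<forall>\<^sub>F \<mu> in at_left \<mu>0. u x t \<le> u (reflect k \<mu> x) t"
        using eventually_at_left_real[OF x]
        by eventually_elim (use good_below in \<open>auto simp: good_def\<close>)
      ultimately show "u x t \<le> u (reflect k \<mu>0 x) t" by (rule tendsto_lowerbound) simp
    qed
    define \<Lambda> where "\<Lambda> = \<mu>0 + 1"
    obtain \<rho> where \<rho>: "\<rho> < \<Lambda>" "\<forall>r<\<rho>. 0 < f r \<longrightarrow> f r * L * (\<Lambda> - r) powr (2 * s) < c"
      using left[of \<Lambda>] by blast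
    define F where "F = \<bar>f \<Lambda>\<bar> + 1"
    have F0: "0 < F" by (simp add: F_def)
    have fF: "f r \<le> F" if "r \<le> \<Lambda>" for r
      using strict_mono_leD[OF f_mono that] by (simp add: F_def)
    (* For planes just beyond the infimum a failure point has distance at least d0 to the plane,
       since c <= F * L * (distance) powr (2 * s), and there u is at least b, since otherwise g has
       slope at most epsilon, which is too small for the same inequality. So the jump term is at least
       H * g (b / 2), while the violation m and hence the right-hand side tend to zero. *)
    define d0 where "d0 = (c / (F * L)) powr (1 / (2 * s))"
    have d00: "0 < d0" using c0 F0 L by (simp add: d0_def)
    have d0p: "d0 powr (2 * s) = c / (F * L)" using c0 F0 L s by (simp add: d0_def powr_powr)
    define \<epsilon> where "\<epsilon> = c / (2 * F * (\<Lambda> - \<rho>) powr (2 * s))"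
    have e0: "0 < \<epsilon>" using c0 F0 \<rho>(1) by (simp add: \<epsilon>_def)
    obtain b where b: "0 < b" "\<epsilon>-lipschitz_on {0..b} g" using slope[OF e0] by blast
    define H where "H = f (\<mu>0 + d0) - f (\<mu>0 - d0 / 2)"
    have H0: "0 < H" unfolding H_def using f_mono d00 by (simp add: strict_mono_def)
    have gb: "0 < g (b / 2)" using b gpos by simp
    define \<eta> where "\<eta> = min (b / 2) (H * g (b / 2) / (2 * F * L))"
    have eta0: "0 < \<eta>" using b H0 gb F0 L by (simp add: \<eta>_def)
    obtain \<theta> where \<theta>: "0 < \<theta>" "\<And>x y t. norm (x - y) < \<theta> \<Longrightarrow> \<bar>u x t - u y t\<bar> < \<eta>"
    proof -
      obtain \<theta> where "0 < \<theta>" and d: "\<And>p q. dist p q < \<theta> \<Longrightarrow> dist (case p of (x, t) \<Rightarrow> u x t) (case q of (x, t) \<Rightarrow> u x t) < \<eta>"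
        using u_uc eta0 unfolding uniformly_continuous_on_def by (metis UNIV_I)
      then show ?thesis
        using that[of \<theta>] d[of "(_, _)" "(_, _)"] by (auto simp: dist_Pair_Pair dist_norm)
    qed
    have "\<mu>0 < \<mu>0 + min 1 (min (d0 / 2) (\<theta> / 2))" using d00 \<theta> by simp
    from cInf_lessD[OF B this[unfolded \<mu>0_def]] obtain \<mu> where \<mu>: "\<not> good \<mu>"
      and \<mu>lt: "\<mu> < \<mu>0 + min 1 (min (d0 / 2) (\<theta> / 2))" by (auto simp: B_def \<mu>0_def)
    have \<mu>ge: "\<mu>0 \<le> \<mu>" using cInf_lower[OF _ Bb, of \<mu>] \<mu> by (simp add: \<mu>0_def B_def)
    from failure[OF \<mu>] obtain m x t where m: "0 < m" and
      x: "x $ k < \<mu>" "u (reflect k \<mu> x) t < u x t" "u x t - u (reflect k \<mu> x) t \<le> m" "0 < f (x $ k)" and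
      least: "\<And>\<eta>. (\<forall>x t. x $ k < \<mu> \<longrightarrow> u x t - u (reflect k \<mu> x) t \<le> \<eta>) \<Longrightarrow> m \<le> \<eta>" and
      ineq: "c * m * (\<mu> - x $ k) powr (- 2 * s)
        + (f (2 * \<mu> - x $ k) - f (x $ k)) * g (u (reflect k \<mu> x) t)
        \<le> f (x $ k) * (g (u x t) - g (u (reflect k \<mu> x) t))" by blast
    note sl = slope_ineq[OF m x ineq]
    have m_le: "m \<le> \<eta>"
    proof (rule least, intro allI impI)
      fix y \<tau> assume y: "y $ k < \<mu>"
      show "u y \<tau> - u (reflect k \<mu> y) \<tau> \<le> \<eta>"
      proof (cases "y $ k < \<mu>0")
        case True
        have "reflect k \<mu>0 y - reflect k \<mu> y = (2 * (\<mu>0 - \<mu>)) *\<^sub>R axis k 1"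
          by (auto simp: vec_eq_iff reflect_nth axis_def)
        then have "norm (reflect k \<mu>0 y - reflect k \<mu> y) < \<theta>" using \<mu>ge \<mu>lt by simp
        from \<theta>(2)[OF this, of \<tau>] have "u (reflect k \<mu>0 y) \<tau> - u (reflect k \<mu> y) \<tau> < \<eta>" by linarith
        moreover have "u y \<tau> \<le> u (reflect k \<mu>0 y) \<tau>" using good0 True by (simp add: good_def)
        ultimately show ?thesis by simp
      next
        case False
        have "y - reflect k \<mu> y = (2 * (y $ k - \<mu>)) *\<^sub>R axis k 1"
          by (auto simp: vec_eq_iff reflect_nth axis_def)
        then have "norm (y - reflect k \<mu> y) < \<theta>" using False y \<mu>lt by simp
        from \<theta>(2)[OF this, of \<tau>] show ?thesis by linarith
      qed
    qed
    have \<mu>\<Lambda>: "\<mu> \<le> \<Lambda>" using \<mu>lt by (simp add: \<Lambda>_def)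
    have xF: "f (x $ k) \<le> F" using fF[of "x $ k"] x(1) \<mu>\<Lambda> by simp
    have x\<rho>: "\<rho> \<le> x $ k" by (rule confined[OF \<rho>(2) x(1) \<mu>\<Lambda> x(4) sl[OF L uM]])
    have gap: "d0 \<le> \<mu> - x $ k"
    proof -
      have "c \<le> F * L * (\<mu> - x $ k) powr (2 * s)"
        by (rule order_trans[OF sl[OF L uM]]) (use xF L in \<open>intro mult_right_mono; simp\<close>)
      then have "d0 powr (2 * s) \<le> (\<mu> - x $ k) powr (2 * s)"
        unfolding d0p using F0 L(1) by (subst pos_divide_le_eq) (simp_all add: mult_ac)
      then show ?thesis using powr_less_mono2[of "2 * s" "\<mu> - x $ k" d0] s x(1) by force
    qed
    have ub: "b < u x t"
    proof (rule ccontr)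
      assume "\<not> b < u x t"
      then have "c \<le> f (x $ k) * \<epsilon> * (\<mu> - x $ k) powr (2 * s)" using sl[OF e0 b(2)] by simp
      also have "\<dots> \<le> F * \<epsilon> * (\<Lambda> - \<rho>) powr (2 * s)"
        using xF x x\<rho> \<mu>\<Lambda> e0 s F0 by (intro mult_mono powr_mono2) auto
      also have "\<dots> = c / 2" using F0 \<rho>(1) by (simp add: \<epsilon>_def)
      finally show False using c0 by simp
    qed
    have "b / 2 \<le> u (reflect k \<mu> x) t" using ub x(3) m_le by (simp add: \<eta>_def)
    then have gR: "g (b / 2) \<le> g (u (reflect k \<mu> x) t)"
      using g_mono b(1) upos by (simp add: mono_on_def)
    have fR: "H \<le> f (2 * \<mu> - x $ k) - f (x $ k)"
    proof -
      have "f (\<mu>0 + d0) \<le> f (2 * \<mu> - x $ k)" using gap \<mu>ge by (intro strict_mono_leD[OF f_mono]) simp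
      moreover have "f (x $ k) \<le> f (\<mu>0 - d0 / 2)" using gap \<mu>lt by (intro strict_mono_leD[OF f_mono]) simp
      ultimately show ?thesis by (simp add: H_def)
    qed
    have "H * g (b / 2) \<le> (f (2 * \<mu> - x $ k) - f (x $ k)) * g (u (reflect k \<mu> x) t)"
      using fR gR H0 gb by (intro mult_mono) auto
    also have "\<dots> \<le> f (x $ k) * (g (u x t) - g (u (reflect k \<mu> x) t))"
    proof -
      have "0 \<le> c * m * (\<mu> - x $ k) powr (- 2 * s)" using c0 m by simp
      with ineq show ?thesis by linarith
    qed
    also have "\<dots> \<le> F * (L * \<eta>)"
    proof (rule mult_mono)
      have "g (u x t) - g (u (reflect k \<mu> x) t) \<le> L * (u x t - u (reflect k \<mu> x) t)"
        using lipschitz_onD[OF L(2), of "u x t" "u (reflect k \<mu> x) t"] uM x(2) upos[of x t] upos[of "reflect k \<mu> x" t]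
        by (simp add: dist_real_def abs_le_iff less_imp_le)
      also have "\<dots> \<le> L * \<eta>" using x(3) m_le L by simp
      finally show "g (u x t) - g (u (reflect k \<mu> x) t) \<le> L * \<eta>" .
      show "0 \<le> g (u x t) - g (u (reflect k \<mu> x) t)"
        using g_mono x(2) upos by (simp add: mono_on_def)
    qed (use xF F0 in auto)
    also have "\<dots> \<le> F * (L * (H * g (b / 2) / (2 * F * L)))"
      using F0 L by (intro mult_left_mono) (auto simp: \<eta>_def)
    also have "\<dots> = H * g (b / 2) / 2" using F0 L by simp
    finally show False using H0 gb by simp
  qed
  show ?thesis
  proof (intro allI impI)
    fix t x and h :: real assume h: "0 < h"
    define \<mu> where "\<mu> = x $ k + h / 2"
    have x: "x $ k < \<mu>" using h by (simp add: \<mu>_def)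
    have R: "reflect k \<mu> x = x + h *\<^sub>R axis k 1" by (simp add: reflect_def \<mu>_def)
    have le: "u x t \<le> u (reflect k \<mu> x) t" if "x $ k < \<mu>" for x t
      using all_good[of \<mu>] that by (simp add: good_def)
    have "u (reflect k \<mu> x) t \<noteq> u x t"
    proof
      assume eq: "u (reflect k \<mu> x) t = u x t"
      have "evolution_op s \<alpha> u (reflect k \<mu> x) t \<le> evolution_op s \<alpha> u x t"
        by (rule evolution_op_at_zero_minimum[OF s \<alpha> C2 C1 ct[OF continuous_on_id] bd le x eq])
      then have "f (reflect k \<mu> x $ k) * g (u x t) \<le> f (x $ k) * g (u x t)"
        unfolding pde eq .
      then have "f (reflect k \<mu> x $ k) \<le> f (x $ k)" using gpos[OF upos, of x t] by simp
      moreover have "f (x $ k) < f (reflect k \<mu> x $ k)"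
        using f_mono x by (simp add: strict_mono_def reflect_nth)
      ultimately show False by simp
    qed
    then show "u x t < u (x + h *\<^sub>R axis k 1) t" using le[OF x, of t] R by simp
  qed
qed

end
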